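(* Let $m \geq 2$, let $D \subset \mathbb{R}^m$ be a domain, let $\lambda \in \mathbb{C}$, and let $u \in C^2(D)$ be metaharmonic in $D$, i.e. $\nabla^2 u + \lambda^2 u = 0$ in $D$. Then the equality $$\int_{\partial B_r(x)} \frac{\partial u}{\partial n_y} \, dS_y = - \lambda^2 \left( \frac{2 \pi r}{\lambda} \right)^{m/2} J_{m/2}(\lambda r) \, u(x)$$ holds for every admissible ball $B_r(x)$.
   Context: A domain is an open connected subset of $\mathbb{R}^m$. $\nabla^2$ is the Laplacian. $B_r(x) = \{ y \in \mathbb{R}^m : |y-x| < r\}$ with $x \in D$, $r>0$; the ball is called admissible if its closure satisfies $\overline{B_r(x)} \subset D$. $n$ denotes the exterior unit normal to $\partial B_r(x)$, $dS$ the surface measure, and $J_\nu$ the Bessel function of the first kind of order $\nu$. The product $(2\pi r/\lambda)^{m/2} J_{m/2}(\lambda r)$ is understood (with consistent branches of the powers, and by continuity at $\lambda = 0$) as the entire function of $\lambda$ given by $\pi^{m/2} r^m \sum_{k=0}^\infty \frac{(-1)^k (\lambda r/2)^{2k}}{k!\,\Gamma(k + m/2 + 1)}$. *)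

theory Defs
  imports "HOL-Analysis.Analysis"
begin

definition dir_deriv :: "'a::real_normed_vector \<Rightarrow> ('a \<Rightarrow> 'b::real_normed_vector) \<Rightarrow> 'a \<Rightarrow> 'b"
  where "dir_deriv v f x = vector_derivative (\<lambda>t. f (x + t *\<^sub>R v)) (at 0)"

text \<open>
  The classes \<open>C\<^sup>1(D)\<close> and \<open>C\<^sup>2(D)\<close>, for open \<open>D\<close>: all partial derivatives up to the given order
  exist and are continuous on \<open>D\<close>.  Since \<open>vector_derivative\<close> is total, existence is
  required explicitly.
\<close>

definition C1_on :: "'a::euclidean_space set \<Rightarrow> ('a \<Rightarrow> 'b::real_normed_vector) \<Rightarrow> bool"
  where "C1_on D f \<longleftrightarrow> continuous_on D f \<and>
    (\<forall>i\<in>Basis. (\<forall>x\<in>D. (\<lambda>t::real. f (x + t *\<^sub>R i)) differentiable (at 0)) \<and>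
               continuous_on D (dir_deriv i f))"

definition C2_on :: "'a::euclidean_space set \<Rightarrow> ('a \<Rightarrow> 'b::real_normed_vector) \<Rightarrow> bool"
  where "C2_on D f \<longleftrightarrow> C1_on D f \<and> (\<forall>i\<in>Basis. C1_on D (dir_deriv i f))"

definition laplacian :: "('a::euclidean_space \<Rightarrow> 'b::real_normed_vector) \<Rightarrow> 'a \<Rightarrow> 'b"
  where "laplacian f x = (\<Sum>i\<in>Basis. dir_deriv i (dir_deriv i f) x)"

definition metaharmonic_on :: "complex \<Rightarrow> 'a::euclidean_space set \<Rightarrow> ('a \<Rightarrow> complex) \<Rightarrow> bool"
  where "metaharmonic_on lam D u \<longleftrightarrow> (\<forall>x\<in>D. laplacian u x + lam\<^sup>2 * u x = 0)"

definition admissible_ball :: "'a::metric_space set \<Rightarrow> 'a \<Rightarrow> real \<Rightarrow> bool"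
  where "admissible_ball D x r \<longleftrightarrow> x \<in> D \<and> r > 0 \<and> closure (ball x r) \<subseteq> D"

text \<open>
  Exterior unit normal to the sphere of radius \<open>r\<close> about \<open>x\<close>, at the point \<open>y\<close>, and the
  corresponding normal derivative.
\<close>

definition sphere_normal :: "'a::real_normed_vector \<Rightarrow> real \<Rightarrow> 'a \<Rightarrow> 'a"
  where "sphere_normal x r y = (y - x) /\<^sub>R r"

definition normal_deriv :: "'a::real_normed_vector \<Rightarrow> real \<Rightarrow> ('a \<Rightarrow> 'b::real_normed_vector) \<Rightarrow> 'a \<Rightarrow> 'b"
  where "normal_deriv x r f y = dir_deriv (sphere_normal x r y) f y"

text \<open>
  Surface measure on the sphere of radius \<open>r > 0\<close> about \<open>x\<close> in \<open>m\<close>-dimensional space, defined in the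
  usual way from Lebesgue measure: the area of a Borel subset \<open>A\<close> of the sphere is \<open>m / r\<close> times the
  volume of the solid cone over \<open>A\<close> with apex \<open>x\<close>.  As a measure, this is the scaled image of Lebesgue
  measure on the punctured ball under radial projection; see \<open>emeasure_sphere_measure\<close>
  and \<open>emeasure_sphere_measure_total\<close> below.
\<close>

definition sphere_measure :: "'a::euclidean_space \<Rightarrow> real \<Rightarrow> 'a measure"
  where "sphere_measure x r =
    scale_measure (ennreal (real DIM('a) / r))
      (distr (restrict_space lborel (ball x r - {x})) (restrict_space borel (sphere x r))
        (\<lambda>y. x + r *\<^sub>R sgn (y - x)))"

text \<open>
  The Bessel function of the first kind, with the principal branch of the power.
  (At \<open>z = 0\<close> it is correct only for \<open>\<nu> \<noteq> 0\<close>, because \<open>0 powr 0 = 0\<close>.)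
\<close>

definition bessel_J :: "complex \<Rightarrow> complex \<Rightarrow> complex"
  where "bessel_J \<nu> z = (z / 2) powr \<nu> *
    (\<Sum>k. (-1) ^ k * (z / 2) ^ (2 * k) / (fact k * Gamma (of_nat k + \<nu> + 1)))"

text \<open>
  The product \<open>(2 pi r / lam) ^ (m / 2) * J\<^bsub>m / 2\<^esub> (lam r)\<close> as an entire function of \<open>lam\<close>.
  Its agreement with the literal product for \<open>lam \<noteq> 0\<close> is \<open>bessel_product_eq\<close>; there the power
  is written as a quotient so that the same branch of \<open>lam ^ (m / 2)\<close> occurs in both factors.
\<close>

definition bessel_product :: "nat \<Rightarrow> real \<Rightarrow> complex \<Rightarrow> complex"
  where "bessel_product m r lam = of_real (pi powr (real m / 2) * r ^ m) *
    (\<Sum>k. (-1) ^ k * (lam * of_real r / 2) ^ (2 * k) /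
          (fact k * Gamma (of_nat k + of_nat m / 2 + 1)))"

lemma bessel_product_eq:
  assumes "r > 0" "lam \<noteq> 0"
  shows "bessel_product m r lam =
    (of_real (2 * pi * r) powr (of_nat m / 2) / lam powr (of_nat m / 2)) *
    bessel_J (of_nat m / 2) (lam * of_real r)"
proof -
  let ?s = "of_nat m / 2 :: complex"
  have s: "?s = of_real (real m / 2)" by simp
  have "(lam * of_real r / 2) powr ?s = (of_real (r / 2) * lam) powr ?s"
    by (simp add: mult.commute)
  also have "\<dots> = of_real (r / 2) powr ?s * lam powr ?s"
    using assms by (subst powr_times_real_left) auto
  finally have 1: "(lam * of_real r / 2) powr ?s = of_real (r / 2) powr ?s * lam powr ?s" .
  have "of_real (2 * pi * r) powr ?s * of_real (r / 2) powr ?s =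
      (of_real ((2 * pi * r) powr (real m / 2) * (r / 2) powr (real m / 2)) :: complex)"
    unfolding s using assms by (subst (1 2) powr_of_real) auto
  also have "(2 * pi * r) powr (real m / 2) * (r / 2) powr (real m / 2) =
      (pi * r ^ 2) powr (real m / 2)"
    using assms by (subst powr_mult [symmetric]) (auto simp: power2_eq_square)
  also have "\<dots> = pi powr (real m / 2) * r ^ m"
    using assms by (simp add: powr_mult powr_powr powr_realpow flip: powr_numeral)
  finally have 2: "of_real (2 * pi * r) powr ?s * of_real (r / 2) powr ?s =
      (of_real (pi powr (real m / 2) * r ^ m) :: complex)" .
  show ?thesis
    unfolding bessel_product_def bessel_J_def 1 2 [symmetric] using assms by simp
qed

lemma space_sphere_measure [simp]: "space (sphere_measure x r) = sphere x r"
  by (simp add: sphere_measure_def space_scale_measure space_restrict_space)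

lemma sets_sphere_measure: "sets (sphere_measure x r) = sets (restrict_space borel (sphere x r))"
  by (simp add: sphere_measure_def)

lemma emeasure_sphere_measure:
  fixes x :: "'a::euclidean_space"
  assumes r: "r > 0" and A: "A \<in> sets borel" "A \<subseteq> sphere x r"
  shows "emeasure (sphere_measure x r) A =
    ennreal (real DIM('a) / r) *
    emeasure lborel {x + t *\<^sub>R (y - x) | t y. 0 < t \<and> t < 1 \<and> y \<in> A}"
proof -
  let ?f = "\<lambda>y. x + r *\<^sub>R sgn (y - x)" and ?B = "ball x r - {x}"
  have on: "?f y \<in> sphere x r" if "y \<noteq> x" for y
    using that r by (simp add: dist_norm norm_sgn)
  have f: "?f \<in> restrict_space lborel ?B \<rightarrow>\<^sub>M restrict_space borel (sphere x r)"
  proof (rule measurable_restrict_space2)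
    show "?f \<in> space (restrict_space lborel ?B) \<rightarrow> sphere x r"
      using on by (auto simp: space_restrict_space)
    show "?f \<in> restrict_space lborel ?B \<rightarrow>\<^sub>M borel"
      unfolding sgn_div_norm by (rule measurable_restrict_space1) measurable
  qed
  have A': "A \<in> sets (restrict_space borel (sphere x r))"
    using A by (auto simp: sets_restrict_space image_iff)
  have cone: "?f -` A \<inter> ?B = {x + t *\<^sub>R (y - x) | t y. 0 < t \<and> t < 1 \<and> y \<in> A}" (is "_ = ?C")
  proof (intro set_eqI iffI)
    fix z assume z: "z \<in> ?f -` A \<inter> ?B"
    then have nz: "z \<noteq> x" "norm (z - x) < r" "?f z \<in> A"
      by (auto simp: dist_norm norm_minus_commute)
    have "z = x + (norm (z - x) / r) *\<^sub>R (?f z - x)"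
      using nz r by (simp add: sgn_div_norm)
    moreover have "0 < norm (z - x) / r" "norm (z - x) / r < 1"
      using nz r by auto
    ultimately show "z \<in> ?C"
      using nz by blast
  next
    fix z assume "z \<in> ?C"
    then obtain t y where ty: "z = x + t *\<^sub>R (y - x)" "0 < t" "t < 1" "y \<in> A"
      by blast
    have ny: "norm (y - x) = r"
      using ty A by (auto simp: dist_norm norm_minus_commute)
    have "sgn (z - x) = (y - x) /\<^sub>R r"
      using ty ny by (simp add: sgn_scaleR sgn_div_norm)
    then have "?f z = y" "z \<noteq> x" "norm (z - x) < r"
      using ty ny r by auto
    then show "z \<in> ?f -` A \<inter> ?B"
      using ty by (auto simp: dist_norm norm_minus_commute)
  qed
  have "emeasure (sphere_measure x r) A =
      ennreal (real DIM('a) / r) * emeasure (restrict_space lborel ?B) (?f -` A \<inter> ?B)"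
    using f A' by (simp add: sphere_measure_def emeasure_distr space_restrict_space)
  also have "emeasure (restrict_space lborel ?B) (?f -` A \<inter> ?B) = emeasure lborel (?f -` A \<inter> ?B)"
    by (rule emeasure_restrict_space) auto
  finally show ?thesis
    by (simp only: cone)
qed

lemma emeasure_sphere_measure_total:
  fixes x :: "'a::euclidean_space"
  assumes r: "r > 0"
  shows "emeasure (sphere_measure x r) (sphere x r) =
    ennreal (real DIM('a) * unit_ball_vol (real DIM('a)) * r ^ (DIM('a) - 1))"
proof -
  have C: "{x + t *\<^sub>R (y - x) | t y. 0 < t \<and> t < 1 \<and> y \<in> sphere x r} = ball x r - {x}"
    (is "?C = _")
  proof (intro set_eqI iffI)
    fix z assume "z \<in> ?C"
    then obtain t y where ty: "z = x + t *\<^sub>R (y - x)" "0 < t" "t < 1" "y \<in> sphere x r"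
      by blast
    then have "norm (y - x) = r"
      by (auto simp: dist_norm norm_minus_commute)
    then show "z \<in> ball x r - {x}"
      using ty r by (auto simp: dist_norm)
  next
    fix z assume z: "z \<in> ball x r - {x}"
    then have nz: "z \<noteq> x" "norm (z - x) < r"
      by (auto simp: dist_norm norm_minus_commute)
    let ?y = "x + r *\<^sub>R sgn (z - x)"
    have "z = x + (norm (z - x) / r) *\<^sub>R (?y - x)" "?y \<in> sphere x r"
      using nz r by (auto simp: sgn_div_norm dist_norm)
    moreover have "0 < norm (z - x) / r" "norm (z - x) / r < 1"
      using nz r by auto
    ultimately show "z \<in> ?C"
      by blast
  qed
  have "emeasure lborel (ball x r - {x}) = emeasure lborel (ball x r)"
    by (rule emeasure_Diff_null_set) (auto simp: null_sets_def)
  also have "\<dots> = ennreal (unit_ball_vol (real DIM('a)) * r ^ DIM('a))"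
    using r by (simp add: emeasure_ball)
  finally have "emeasure (sphere_measure x r) (sphere x r) =
      ennreal (real DIM('a) / r) * ennreal (unit_ball_vol (real DIM('a)) * r ^ DIM('a))"
    using emeasure_sphere_measure [OF r, of "sphere x r" x] by (simp only: C) simp
  also have "\<dots> = ennreal (real DIM('a) / r * (unit_ball_vol (real DIM('a)) * r ^ DIM('a)))"
    using r by (intro ennreal_mult [symmetric]) auto
  also have "real DIM('a) / r * (unit_ball_vol (real DIM('a)) * r ^ DIM('a)) =
      real DIM('a) * unit_ball_vol (real DIM('a)) * r ^ (DIM('a) - 1)"
    using r by (simp add: power_eq_if)
  finally show ?thesis .
qed

end

theory Submission
  imports Defs
begin

text \<open>
  Rescale the ball to the unit ball and put \<open>v z = u (x + r z)\<close>, so that \<open>\<nabla>\<^sup>2 v = c v\<close> with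
  \<open>c = - \<lambda>\<^sup>2 r\<^sup>2\<close>. By the divergence theorem the flux is \<open>r\<^bsup>m-2\<^esup> c\<close> times the integral of \<open>v\<close> over the
  unit ball. To compute that integral, consider the weighted means
  \<open>b\<^sub>k s = \<integral> (1 - |y|\<^sup>2)\<^sup>k v (s y) dy\<close> over the unit ball. Differentiating in \<open>s\<close> and integrating by parts
  with the weight \<open>(1 - |y|\<^sup>2)\<^bsup>k+1\<^esup>\<close>, which vanishes on the sphere, gives
  \<open>b\<^sub>k' = (c s / (2 (k + 1))) b\<^bsub>k+1\<^esub>\<close>. Since \<open>b\<^sub>k\<close> is bounded uniformly in \<open>k\<close>, a Taylor expansion of
  \<open>b\<^sub>0\<close> in \<open>s\<^sup>2\<close> converges, and the moments \<open>b\<^sub>k 0 = v 0 \<integral> (1 - |y|\<^sup>2)\<^sup>k dy\<close> turn it into the Bessel series.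
\<close>

section \<open>Differentiation under the integral and total derivatives\<close>

text \<open>The weights form a closed system: radial differentiation brings out y . grad v, and (1 -
  |y|^2)^k y is the gradient of -(1 - |y|^2)^(k+1) / (2 (k+1)), so one integration by parts yields a
  Laplacian together with the next weight. In the variable s^2 the rule reads d b_k / d(s^2) = (c/4)
  b_(k+1) / (k+1), the origin of c/4 = -(lambda r / 2)^2. Iterating, the k-th Taylor coefficient of
  b_0 at 0 is (c/4)^k b_k(0) / (k!)^2; the moment contributes k! / Gamma(k + m/2 + 1), which leaves
  exactly the factorial and the Gamma value of the Bessel series. No singular differential equation
  in the radius has to be solved, and lambda = 0 is not a special case. Two obstacles shape the
  rest. Surface measure is only an image of Lebesgue measure, so the divergence theorem is derived
  from translation invariance and a limit over thin shells instead of boundary charts. And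
  \<open>C2_on\<close> speaks of partial derivatives only, while radial and normal derivatives need
  a total derivative.\<close>

lemma has_vector_derivative_iff_quotient:
  fixes f :: "real \<Rightarrow> 'b::real_normed_vector"
  shows "(f has_vector_derivative D) (at s within S) \<longleftrightarrow>
    ((\<lambda>t. (1 / (t - s)) *\<^sub>R (f t - f s)) \<longlongrightarrow> D) (at s within S)"
proof -
  have "norm (f t - f s - (t - s) *\<^sub>R D) / norm (t - s) = norm ((1 / (t - s)) *\<^sub>R (f t - f s) - D)"
    if "t \<noteq> s" for t
  proof -
    have "(1 / (t - s)) *\<^sub>R (f t - f s) - D = (1 / (t - s)) *\<^sub>R (f t - f s - (t - s) *\<^sub>R D)"
      using that by (simp add: scaleR_diff_right)
    then show ?thesis
      by (simp only: norm_scaleR) simp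
  qed
  then have "((\<lambda>t. norm (f t - f s - (t - s) *\<^sub>R D) / norm (t - s)) \<longlongrightarrow> 0) (at s within S) \<longleftrightarrow>
      ((\<lambda>t. norm ((1 / (t - s)) *\<^sub>R (f t - f s) - D)) \<longlongrightarrow> 0) (at s within S)"
    by (intro tendsto_cong) (simp add: eventually_at_filter)
  then show ?thesis
    unfolding has_vector_derivative_def has_derivative_iff_norm
    by (simp add: bounded_linear_scaleR_left tendsto_norm_zero_iff flip: LIM_zero_iff[of _ D])
qed

text \<open>Dominated convergence for the difference quotients. The domination is a Lipschitz bound
  at \<open>s\<close>, not a bound on a derivative near \<open>s\<close>: the function cut off near
  the sphere has kinks, so it is differentiable only almost everywhere. The set \<open>S\<close>
  allows one-sided derivatives at the ends of an interval.\<close>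

lemma has_vector_derivative_lebesgue_integral:
  fixes F :: "real \<Rightarrow> 'a \<Rightarrow> 'b::{banach, second_countable_topology}"
  assumes d: "d > 0" and s: "s \<in> S"
    and int: "\<And>t. t \<in> S \<Longrightarrow> \<bar>t - s\<bar> < d \<Longrightarrow> integrable M (F t)"
    and F': "F' \<in> borel_measurable M"
    and der: "AE y in M. ((\<lambda>t. F t y) has_vector_derivative F' y) (at s within S)"
    and K: "integrable M K"
    and bound: "\<And>t y. t \<in> S \<Longrightarrow> \<bar>t - s\<bar> < d \<Longrightarrow> y \<in> space M \<Longrightarrow>
      norm (F t y - F s y) \<le> \<bar>t - s\<bar> * K y"
  shows "((\<lambda>t. LINT y|M. F t y) has_vector_derivative (LINT y|M. F' y)) (at s within S)"
proof -
  have quot: "((\<lambda>t. (1 / (t - s)) *\<^sub>R ((LINT y|M. F t y) - (LINT y|M. F s y))) \<longlongrightarrow> (LINT y|M. F' y))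
    (at s within S)"
    unfolding tendsto_at_iff_sequentially comp_def
  proof (intro allI impI)
    fix X :: "nat \<Rightarrow> real"
    assume X: "\<forall>i. X i \<in> S - {s}" "X \<longlonglongrightarrow> s"
    obtain N where N: "\<And>n. n \<ge> N \<Longrightarrow> \<bar>X n - s\<bar> < d"
      using LIMSEQ_D[OF X(2) d] by auto
    \<comment> \<open>The hypotheses hold only within distance \<open>d\<close> of \<open>s\<close>,
      so an initial segment of the sequence is dropped.\<close>
    define Y where "Y n = X (n + N)" for n
    have Y: "Y n \<in> S" "Y n \<noteq> s" "\<bar>Y n - s\<bar> < d" for n
      using X(1) N by (auto simp: Y_def)
    have Ylim: "Y \<longlonglongrightarrow> s"
      unfolding Y_def by (rule LIMSEQ_ignore_initial_segment) (fact X(2))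
    have ints: "integrable M (F (Y n))" "integrable M (F s)" for n
      using int Y s d by auto
    have "(\<lambda>n. LINT y|M. (1 / (Y n - s)) *\<^sub>R (F (Y n) y - F s y)) \<longlonglongrightarrow> (LINT y|M. F' y)"
    proof (rule integral_dominated_convergence[where w = K])
      show "AE y in M. (\<lambda>n. (1 / (Y n - s)) *\<^sub>R (F (Y n) y - F s y)) \<longlonglongrightarrow> F' y"
        using der
      proof eventually_elim
        case (elim y)
        then have "((\<lambda>t. (1 / (t - s)) *\<^sub>R (F t y - F s y)) \<longlongrightarrow> F' y) (at s within S)"
          by (simp add: has_vector_derivative_iff_quotient)
        then show ?case
          using Y Ylim unfolding tendsto_at_iff_sequentially comp_def by auto
      qed
      show "AE y in M. norm ((1 / (Y n - s)) *\<^sub>R (F (Y n) y - F s y)) \<le> K y" for n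
      proof (rule AE_I2)
        fix y assume "y \<in> space M"
        then have "norm (F (Y n) y - F s y) \<le> \<bar>Y n - s\<bar> * K y"
          using bound Y by blast
        then show "norm ((1 / (Y n - s)) *\<^sub>R (F (Y n) y - F s y)) \<le> K y"
          unfolding norm_scaleR using Y(2)[of n] by (simp add: field_simps)
      qed
    qed (use ints F' K in auto)
    then have "(\<lambda>n. (1 / (Y n - s)) *\<^sub>R ((LINT y|M. F (Y n) y) - (LINT y|M. F s y))) \<longlonglongrightarrow> (LINT y|M. F' y)"
      using ints by simp
    then show "(\<lambda>n. (1 / (X n - s)) *\<^sub>R ((LINT y|M. F (X n) y) - (LINT y|M. F s y))) \<longlonglongrightarrow> (LINT y|M. F' y)"
      unfolding Y_def by (rule LIMSEQ_offset)
  qed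
  then show ?thesis
    by (simp add: has_vector_derivative_iff_quotient)
qed

lemma integral_lborel_affine:
  fixes f :: "'a::euclidean_space \<Rightarrow> 'b::{banach, second_countable_topology}"
  assumes c: "c > 0" and f: "f \<in> borel_measurable borel"
  shows "(LINT y|lborel. f y) = c ^ DIM('a) *\<^sub>R (LINT y|lborel. f (a + c *\<^sub>R y))"
proof -
  have "(LINT y|lborel. f y) =
      (LINT y|density (distr lborel borel (\<lambda>y. a + c *\<^sub>R y)) (\<lambda>_. ennreal (c ^ DIM('a))). f y)"
    using lborel_affine[of c a] c by simp
  also have "\<dots> = (LINT y|distr lborel borel (\<lambda>y. a + c *\<^sub>R y). c ^ DIM('a) *\<^sub>R f y)"
    using c f by (intro integral_density) auto
  also have "\<dots> = (LINT y|lborel. c ^ DIM('a) *\<^sub>R f (a + c *\<^sub>R y))"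
    using f by (intro integral_distr) auto
  finally show ?thesis by simp
qed

text \<open>By translation invariance the integral of \<open>h (y + t *\<^sub>R e)\<close> does not
  depend on \<open>t\<close>; differentiating under the integral at \<open>t = 0\<close> gives zero.
  This takes the place of Fubini and the one-dimensional fundamental theorem.\<close>

lemma integral_directional_derivative_eq_0:
  fixes h :: "'a::euclidean_space \<Rightarrow> 'b::{banach, second_countable_topology}"
  assumes h: "integrable lborel h"
    and h': "h' \<in> borel_measurable borel"
    and der: "AE y in lborel. ((\<lambda>t. h (y + t *\<^sub>R e)) has_vector_derivative h' y) (at 0)"
    and K: "integrable lborel K"
    and bound: "\<And>t y. \<bar>t\<bar> < 1 \<Longrightarrow> norm (h (y + t *\<^sub>R e) - h y) \<le> \<bar>t\<bar> * K y"
  shows "(LINT y|lborel. h' y) = 0"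
proof -
  have shift: "integrable lborel (\<lambda>y. h (y + a))" "(LINT y|lborel. h (y + a)) = (LINT y|lborel. h y)" for a
  proof -
    have "integrable (distr lborel borel ((+) a)) h"
      using h by (simp add: lborel_distr_plus)
    then show "integrable lborel (\<lambda>y. h (y + a))"
      by (subst (asm) integrable_distr_eq) (use h in \<open>auto simp: add.commute\<close>)
    show "(LINT y|lborel. h (y + a)) = (LINT y|lborel. h y)"
      using integral_lborel_affine[of 1 h a] h by (simp add: add.commute)
  qed
  have "((\<lambda>t. LINT y|lborel. h (y + t *\<^sub>R e)) has_vector_derivative (LINT y|lborel. h' y)) (at 0)"
    using assms shift
    by (intro has_vector_derivative_lebesgue_integral[where d = 1 and K = K]) auto
  then have "((\<lambda>t::real. LINT y|lborel. h y) has_vector_derivative (LINT y|lborel. h' y)) (at 0)"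
    by (simp add: shift)
  moreover have "((\<lambda>t::real. LINT y|lborel. h y) has_vector_derivative 0) (at 0)"
    by (rule has_vector_derivative_const)
  ultimately show ?thesis
    by (rule vector_derivative_unique_at)
qed

text \<open>Partial derivatives are stated at parameter 0 of a line through the point; the mean
  value inequality needs them at every parameter of one fixed line.\<close>

lemma has_vector_derivative_along_line:
  fixes y i :: "'a::real_vector"
  assumes "((\<lambda>t. f (y + s *\<^sub>R i + t *\<^sub>R i)) has_vector_derivative D) (at 0)"
  shows "((\<lambda>t. f (y + t *\<^sub>R i)) has_vector_derivative D) (at s within S)"
proof -
  have "((\<lambda>t. f (y + s *\<^sub>R i + t *\<^sub>R i)) \<circ> (\<lambda>t. t - s) has_vector_derivative 1 *\<^sub>R D) (at s)"
    by (rule vector_diff_chain_at) (use assms in \<open>auto intro!: derivative_eq_intros\<close>)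
  moreover have "y + s *\<^sub>R i + (t - s) *\<^sub>R i = y + t *\<^sub>R i" for t
    by (simp add: algebra_simps)
  ultimately show ?thesis
    by (simp add: o_def has_vector_derivative_at_within)
qed

text \<open>Go from \<open>y\<close> to \<open>w\<close> by changing one coordinate at a time. On
  each leg the mean value inequality bounds the deviation from the linear term by
  \<open>e' * norm v\<close>, and \<open>e' = e / DIM('a)\<close> makes the legs add up to
  \<open>e * norm v\<close>.\<close>

lemma has_derivative_of_continuous_partials:
  fixes f :: "'a::euclidean_space \<Rightarrow> 'b::real_normed_vector"
  assumes D: "open D" "y \<in> D"
    and der: "\<And>i z. i \<in> Basis \<Longrightarrow> z \<in> D \<Longrightarrow> ((\<lambda>t. f (z + t *\<^sub>R i)) has_vector_derivative g i z) (at 0)"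
    and cont: "\<And>i. i \<in> Basis \<Longrightarrow> isCont (g i) y"
  shows "(f has_derivative (\<lambda>v. \<Sum>i\<in>Basis. (v \<bullet> i) *\<^sub>R g i y)) (at y)"
  unfolding has_derivative_at_alt
proof (intro conjI allI impI)
  show "bounded_linear (\<lambda>v. \<Sum>i\<in>Basis. (v \<bullet> i) *\<^sub>R g i y)"
    by (intro bounded_linear_sum bounded_linear_compose[OF bounded_linear_scaleR_left] bounded_linear_inner_left)
  fix e :: real assume e: "e > 0"
  define e' where "e' = e / DIM('a)"
  have e': "e' > 0" using e by (simp add: e'_def)
  have "\<forall>\<^sub>F z in nhds y. \<forall>i\<in>Basis. dist (g i z) (g i y) < e'"
    using cont e' by (intro eventually_ball_finite)
      (auto simp: isCont_def tendsto_at_iff_tendsto_nhds intro: tendstoD)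
  moreover have "\<forall>\<^sub>F z in nhds y. z \<in> D"
    using D by (rule eventually_nhds_in_open)
  ultimately have "\<forall>\<^sub>F z in nhds y. z \<in> D \<and> (\<forall>i\<in>Basis. dist (g i z) (g i y) < e')"
    by eventually_elim auto
  then obtain d where d: "d > 0"
    and near: "\<And>z. dist z y < d \<Longrightarrow> z \<in> D \<and> (\<forall>i\<in>Basis. dist (g i z) (g i y) < e')"
    unfolding eventually_nhds_metric by blast
  have "norm (f w - f y - (\<Sum>i\<in>Basis. ((w - y) \<bullet> i) *\<^sub>R g i y)) \<le> e * norm (w - y)"
    if w: "norm (w - y) < d" for w
  proof -
    define v where "v = w - y"
    have partial: "norm (f (y + (\<Sum>i\<in>S. (v \<bullet> i) *\<^sub>R i)) - f y - (\<Sum>i\<in>S. (v \<bullet> i) *\<^sub>R g i y)) \<le> card S * e' * norm v"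
      if "S \<subseteq> Basis" for S
      using finite_subset[OF that finite_Basis] that
    proof (induction S rule: finite_induct)
      case (insert j S)
      define p where "p = y + (\<Sum>i\<in>S. (v \<bullet> i) *\<^sub>R i)"
      \<comment> \<open>With the linear part subtracted, the derivative of \<open>q\<close> is a
        difference of two values of \<open>g j\<close>, small by continuity at
        \<open>y\<close>.\<close>
      define q where "q t = f (p + t *\<^sub>R j) - t *\<^sub>R g j y" for t
      have j: "j \<in> Basis" and S: "S \<subseteq> Basis" using insert by auto
      have comp: "(\<Sum>i\<in>S. (v \<bullet> i) *\<^sub>R i) \<bullet> b = (if b \<in> S then v \<bullet> b else 0)" if "b \<in> Basis" for b
        using that S insert.hyps(1)
        by (auto simp: inner_sum_left inner_Basis if_distrib subset_eq cong: sum.cong if_cong)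
      \<comment> \<open>Every point of the leg differs from \<open>y\<close> by a vector dominated
        by \<open>v\<close> in each coordinate, so it stays within the radius where the partials are
        under control.\<close>
      have close: "dist (p + t *\<^sub>R j) y < d" if t: "t \<in> closed_segment 0 (v \<bullet> j)" for t
      proof -
        have tv: "\<bar>t\<bar> \<le> \<bar>v \<bullet> j\<bar>"
          using t by (auto simp: closed_segment_eq_real_ivl split: if_splits)
        have "norm ((\<Sum>i\<in>S. (v \<bullet> i) *\<^sub>R i) + t *\<^sub>R j) \<le> norm v"
        proof (rule norm_le_componentwise)
          fix b :: 'a assume b: "b \<in> Basis"
          then show "\<bar>((\<Sum>i\<in>S. (v \<bullet> i) *\<^sub>R i) + t *\<^sub>R j) \<bullet> b\<bar> \<le> \<bar>v \<bullet> b\<bar>"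
            using tv insert.hyps(2) j by (auto simp: inner_add_left comp inner_Basis)
        qed
        then show ?thesis
          using w by (simp add: p_def dist_norm v_def algebra_simps)
      qed
      have "norm (q (v \<bullet> j) - q 0) \<le> e' * norm (v \<bullet> j - 0)"
      proof (rule differentiable_bound)
        show "convex (closed_segment 0 (v \<bullet> j))" by simp
        fix t assume t: "t \<in> closed_segment 0 (v \<bullet> j)"
        then have pt: "p + t *\<^sub>R j \<in> D" "dist (g j (p + t *\<^sub>R j)) (g j y) < e'"
          using near close j by auto
        have "((\<lambda>s. f (p + s *\<^sub>R j)) has_vector_derivative g j (p + t *\<^sub>R j)) (at t)"
          by (rule has_vector_derivative_along_line[OF der[OF j pt(1)]])
        then have "(q has_vector_derivative (g j (p + t *\<^sub>R j) - g j y)) (at t)"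
          unfolding q_def by (auto intro!: derivative_eq_intros)
        then show "(q has_derivative (\<lambda>h. h *\<^sub>R (g j (p + t *\<^sub>R j) - g j y))) (at t within closed_segment 0 (v \<bullet> j))"
          by (simp add: has_vector_derivative_def has_derivative_at_withinI)
        show "onorm (\<lambda>h. h *\<^sub>R (g j (p + t *\<^sub>R j) - g j y)) \<le> e'"
          using pt(2) e' by (intro onorm_le) (auto simp: dist_norm mult.commute[of e'] intro!: mult_left_mono)
      qed auto
      also have "e' * norm (v \<bullet> j - 0) \<le> e' * norm v"
        using e' j Basis_le_norm[OF j, of v] by simp
      finally have step: "norm (q (v \<bullet> j) - q 0) \<le> e' * norm v" .
      have "f (y + (\<Sum>i\<in>insert j S. (v \<bullet> i) *\<^sub>R i)) - f y - (\<Sum>i\<in>insert j S. (v \<bullet> i) *\<^sub>R g i y) =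
          (q (v \<bullet> j) - q 0) + (f p - f y - (\<Sum>i\<in>S. (v \<bullet> i) *\<^sub>R g i y))"
        using insert.hyps by (simp add: q_def p_def algebra_simps)
      also have "norm \<dots> \<le> e' * norm v + card S * e' * norm v"
        using step insert.IH[OF S] unfolding p_def by (intro norm_triangle_mono)
      also have "\<dots> = card (insert j S) * e' * norm v"
        using insert.hyps by (simp add: algebra_simps)
      finally show ?case .
    qed auto
    from partial[OF order_refl] show ?thesis
      by (simp add: v_def euclidean_representation e'_def)
  qed
  then show "\<exists>d>0. \<forall>w. norm (w - y) < d \<longrightarrow>
      norm (f w - f y - (\<Sum>i\<in>Basis. ((w - y) \<bullet> i) *\<^sub>R g i y)) \<le> e * norm (w - y)"
    using d by blast
qed

section \<open>The divergence theorem on the unit ball\<close>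

lemma null_sets_sphere:
  fixes a :: "'a::euclidean_space"
  shows "sphere a r \<in> null_sets lborel"
proof -
  have "emeasure lborel (cball a r - ball a r) = emeasure lborel (cball a r) - emeasure lborel (ball a r)"
    using emeasure_bounded_finite[OF bounded_ball, of a r]
    by (intro emeasure_Diff) (auto simp: ball_subset_cball)
  also have "\<dots> = 0"
    by (cases "r \<ge> 0") (auto simp: emeasure_ball emeasure_cball)
  also have "cball a r - ball a r = sphere a r"
    by (auto simp: sphere_def)
  finally show ?thesis
    by (auto simp: null_sets_def)
qed

lemma set_integrable_unit_ball:
  fixes f :: "'a::euclidean_space \<Rightarrow> 'b::{banach, second_countable_topology}"
  assumes "continuous_on (cball 0 1) f"
  shows "set_integrable lborel (ball 0 1) f"
proof (rule set_integrable_subset)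
  show "set_integrable lborel (cball 0 1) f"
    unfolding set_integrable_def using assms by (intro borel_integrable_compact) auto
qed auto

text \<open>\<open>sgn\<close> jumps at the origin, but \<open>sgn 0 = 0\<close> makes the factor
  \<open>sgn y \<bullet> i\<close> vanish there, so the function equals its own restriction to the
  punctured space, where it is continuous.\<close>

lemma radial_projection_integrable:
  fixes f :: "'a::euclidean_space \<Rightarrow> 'b::{banach, second_countable_topology}"
  assumes "continuous_on (cball 0 1) f"
  shows "(\<lambda>y. (sgn y \<bullet> i) *\<^sub>R f (sgn y)) \<in> borel_measurable borel"
    and "set_integrable lborel (ball 0 1) (\<lambda>y. (sgn y \<bullet> i) *\<^sub>R f (sgn y))"
proof -
  have sgn_in: "sgn y \<in> cball 0 1" for y :: 'a
    by (simp add: norm_sgn)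
  have "continuous_on (- {0}) (\<lambda>y. (sgn y \<bullet> i) *\<^sub>R f (sgn y))"
    by (intro continuous_intros continuous_on_compose2[OF assms]) (auto intro: sgn_in simp: norm_sgn)
  then have "(\<lambda>y. indicator (- {0}) y *\<^sub>R ((sgn y \<bullet> i) *\<^sub>R f (sgn y))) \<in> borel_measurable borel"
    by (intro borel_measurable_continuous_on_indicator) auto
  also have "(\<lambda>y. indicator (- {0}) y *\<^sub>R ((sgn y \<bullet> i) *\<^sub>R f (sgn y))) = (\<lambda>y. (sgn y \<bullet> i) *\<^sub>R f (sgn y))"
    by (auto simp: fun_eq_iff split: split_indicator)
  finally show meas: "(\<lambda>y. (sgn y \<bullet> i) *\<^sub>R f (sgn y)) \<in> borel_measurable borel" .
  obtain C where C: "\<And>y. y \<in> cball 0 1 \<Longrightarrow> norm (f y) \<le> C"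
    using continuous_on_compact_bound[OF compact_cball assms] by blast
  have "norm ((sgn y \<bullet> i) *\<^sub>R f (sgn y)) \<le> norm i * C" for y
  proof -
    have "\<bar>sgn y \<bullet> i\<bar> \<le> norm i"
      using Cauchy_Schwarz_ineq2[of "sgn y" i] by (cases "y = 0") (auto simp: norm_sgn)
    then show ?thesis
      using C[OF sgn_in] by (auto intro!: mult_mono)
  qed
  then show "set_integrable lborel (ball 0 1) (\<lambda>y. (sgn y \<bullet> i) *\<^sub>R f (sgn y))"
    using borel_measurable_scaleR[OF borel_measurable_indicator meas, of "ball 0 1"]
    by (intro set_integrable_bound[OF set_integrable_unit_ball[of "\<lambda>_. norm i * C"]])
      (auto simp: set_borel_measurable_def intro!: AE_I2 intro: order_trans[OF _ abs_ge_self])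
qed

text \<open>The integrand is constant along rays from the origin, so scaling the ball only
  contributes the Jacobian. Hence its integral over a shell is known exactly.\<close>

lemma integral_radial_projection_ball:
  fixes f :: "'a::euclidean_space \<Rightarrow> 'b::{banach, second_countable_topology}"
  assumes s: "s > 0" and f: "(\<lambda>y. f (sgn y)) \<in> borel_measurable borel"
  shows "(LINT y:ball 0 s|lborel. f (sgn y)) = s ^ DIM('a) *\<^sub>R (LINT y:ball 0 1|lborel. f (sgn y))"
proof -
  have "indicat_real (ball 0 s) (s *\<^sub>R y) = indicator (ball 0 1) y" "sgn (s *\<^sub>R y) = sgn y" for y :: 'a
    using s by (auto simp: indicator_def sgn_scaleR)
  then show ?thesis
    unfolding set_lebesgue_integral_def
    using integral_lborel_affine[OF s, of "\<lambda>y. indicator (ball 0 s) y *\<^sub>R f (sgn y)" 0]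
      borel_measurable_scaleR[OF borel_measurable_indicator f, of "ball 0 s"]
    by simp
qed

text \<open>
  The cutoff \<open>min 1 ((1 - |y|) / e)\<close> makes \<open>f\<close> vanish on the sphere; its gradient lives on the shell of
  width \<open>e\<close>, which becomes the boundary term as \<open>e\<close> tends to 0.
\<close>

lemma divergence_unit_ball_cutoff:
  fixes f f' :: "'a::euclidean_space \<Rightarrow> 'b::{banach, second_countable_topology}"
  assumes i: "i \<in> Basis" and f: "continuous_on (cball 0 1) f" and f': "continuous_on (cball 0 1) f'"
    and der: "\<And>y. y \<in> ball 0 1 \<Longrightarrow> ((\<lambda>t. f (y + t *\<^sub>R i)) has_vector_derivative f' y) (at 0)"
    and e: "0 < e" "e < 1"
  shows "(LINT y:ball 0 1|lborel. min 1 ((1 - norm y) / e) *\<^sub>R f' y) =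
    (LINT y:ball 0 1 - cball 0 (1 - e)|lborel. (sgn y \<bullet> i) *\<^sub>R f y) /\<^sub>R e"
proof -
  \<comment> \<open>The outer \<open>max 0\<close> makes the cutoff zero outside the ball and
    1/e-Lipschitz on the whole space. Then \<open>h\<close> is defined everywhere, as translation
    invariance requires, although \<open>f\<close> is controlled only on the closed ball.\<close>
  define p where "p y = max 0 (min 1 ((1 - norm y) / e))" for y :: 'a
  define h where "h y = p y *\<^sub>R (indicator (ball 0 1) y *\<^sub>R f y)" for y
  define h' where "h' y = indicator (ball 0 1) y *\<^sub>R (min 1 ((1 - norm y) / e) *\<^sub>R f' y) -
    indicator (ball 0 1 - cball 0 (1 - e)) y *\<^sub>R (((sgn y \<bullet> i) *\<^sub>R f y) /\<^sub>R e)" for y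
  have cont: "continuous_on (cball 0 1) (\<lambda>y. min 1 ((1 - norm y) / e) *\<^sub>R f' y)"
    by (intro continuous_intros f') (use e in auto)
  obtain C where C0: "C \<ge> 0" and C: "\<And>y. y \<in> cball 0 1 \<Longrightarrow> norm (f y) \<le> C"
    using continuous_on_compact_bound[OF compact_cball f] by blast
  obtain C' where C'0: "C' \<ge> 0" and C': "\<And>y. y \<in> cball 0 1 \<Longrightarrow> norm (f' y) \<le> C'"
    using continuous_on_compact_bound[OF compact_cball f'] by blast
  have ni: "norm i = 1" using i by simp
  have p01: "0 \<le> p y" "p y \<le> 1" for y by (auto simp: p_def)
  have p0: "p y = 0" if "norm y \<ge> 1" for y using that e by (auto simp: p_def field_simps)
  have lip: "\<bar>p y - p z\<bar> \<le> norm (y - z) / e" for y z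
  proof -
    have "\<bar>p y - p z\<bar> \<le> \<bar>(1 - norm y) / e - (1 - norm z) / e\<bar>"
      by (auto simp: p_def)
    also have "\<dots> = \<bar>norm y - norm z\<bar> / e"
      using e by (simp add: abs_minus_commute flip: diff_divide_distrib)
    also have "\<dots> \<le> norm (y - z) / e"
      using e norm_triangle_ineq3[of y z] by (intro divide_right_mono) auto
    finally show ?thesis .
  qed
  have h_int: "integrable lborel h"
  proof -
    \<comment> \<open>Since \<open>p\<close> vanishes on the sphere, the open ball may be exchanged
      for the closed one, where continuity on a compact set gives integrability.\<close>
    have "h = (\<lambda>y. indicator (cball 0 1) y *\<^sub>R (p y *\<^sub>R f y))"
      using p0 by (auto simp: h_def fun_eq_iff split: split_indicator)
    moreover have "integrable lborel (\<lambda>y. indicator (cball 0 1) y *\<^sub>R (p y *\<^sub>R f y))"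
      by (intro borel_integrable_compact continuous_intros f)
        (auto simp: p_def intro!: continuous_intros e less_imp_neq[symmetric])
    ultimately show ?thesis by simp
  qed
  have inner_f: "set_integrable lborel (ball 0 1 - cball 0 (1 - e)) (\<lambda>y. ((sgn y \<bullet> i) *\<^sub>R f y) /\<^sub>R e)"
  proof -
    have "continuous_on (cball 0 1 - ball 0 (1 - e)) (\<lambda>y. ((sgn y \<bullet> i) *\<^sub>R f y) /\<^sub>R e)"
      by (intro continuous_intros continuous_on_subset[OF f]) (use e in auto)
    then have "set_integrable lborel (cball 0 1 - ball 0 (1 - e)) (\<lambda>y. ((sgn y \<bullet> i) *\<^sub>R f y) /\<^sub>R e)"
      unfolding set_integrable_def by (intro borel_integrable_compact compact_diff) auto
    then show ?thesis
      by (rule set_integrable_subset) auto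
  qed
  have outer_f': "set_integrable lborel (ball 0 1) (\<lambda>y. min 1 ((1 - norm y) / e) *\<^sub>R f' y)"
    by (rule set_integrable_unit_ball[OF cont])
  have "(LINT y|lborel. h' y) = 0"
  proof (rule integral_directional_derivative_eq_0[OF h_int])
    show "h' \<in> borel_measurable borel"
      using inner_f outer_f' unfolding h'_def set_integrable_def
      by (intro borel_measurable_diff) (auto dest: borel_measurable_integrable)
    \<comment> \<open>The kinks of \<open>p\<close> lie on the spheres of radius 1 and 1 - e, and
      the norm is not differentiable at the origin; all three sets are null.\<close>
    have "AE y in lborel. y \<notin> sphere 0 1" "AE y in lborel. y \<notin> sphere 0 (1 - e)"
      "AE y in lborel. y \<noteq> (0::'a)"
      by (rule AE_not_in null_sets_sphere AE_lborel_singleton)+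
    then show "AE y in lborel. ((\<lambda>t. h (y + t *\<^sub>R i)) has_vector_derivative h' y) (at 0)"
    proof eventually_elim
      case (elim y)
      have tends: "((\<lambda>t. norm (y + t *\<^sub>R i)) \<longlongrightarrow> norm y) (at 0)"
        by (auto intro!: tendsto_eq_intros)
      have near: "\<forall>\<^sub>F t in nhds 0. y + t *\<^sub>R i \<in> S" if "open S" "y \<in> S" for S
      proof -
        have "((\<lambda>t. y + t *\<^sub>R i) \<longlongrightarrow> y + 0 *\<^sub>R i) (nhds 0)"
          by (intro tendsto_intros filterlim_ident)
        then show ?thesis
          using that by (auto dest: topological_tendstoD)
      qed
      consider "norm y < 1 - e" | "1 - e < norm y" "norm y < 1" | "norm y > 1"
        using elim by fastforce
      then show ?case
      proof cases
        case 1
        then have "\<forall>\<^sub>F t in nhds 0. h (y + t *\<^sub>R i) = f (y + t *\<^sub>R i)"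
          using near[of "ball 0 (1 - e)"] e
          by (auto elim!: eventually_mono simp: h_def p_def field_simps max_def min_def)
        moreover have "h' y = f' y"
          using 1 e by (auto simp: h'_def min_def field_simps)
        moreover have "h y = f y"
          using 1 e by (auto simp: h_def p_def field_simps max_def min_def)
        ultimately show ?thesis
          using der[of y] 1 e by (subst has_vector_derivative_cong_ev[where g = "\<lambda>t. f (y + t *\<^sub>R i)"]) (auto elim: eventually_mono)
      next
        case 2
        let ?g = "\<lambda>t. ((1 - norm (y + t *\<^sub>R i)) / e) *\<^sub>R f (y + t *\<^sub>R i)"
        have hg: "h z = ((1 - norm z) / e) *\<^sub>R f z" if "1 - e < norm z" "norm z < 1" for z
          using that e by (simp add: h_def p_def)
        have "\<forall>\<^sub>F t in nhds 0. y + t *\<^sub>R i \<in> ball 0 1 - cball 0 (1 - e)"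
          using 2 by (intro near open_Diff) auto
        then have "\<forall>\<^sub>F t in nhds 0. h (y + t *\<^sub>R i) = ?g t"
          by eventually_elim (use hg in auto)
        moreover have "h y = ?g 0"
          using 2 hg by simp
        moreover have "(?g has_vector_derivative h' y) (at 0)"
        proof -
          have "((\<lambda>t. y + t *\<^sub>R i) has_derivative (\<lambda>t. t *\<^sub>R i)) (at 0)"
            by (auto intro!: derivative_eq_intros)
          from has_derivative_compose[OF this, of norm "\<lambda>h. h \<bullet> sgn y"]
          have "((\<lambda>t. norm (y + t *\<^sub>R i)) has_derivative (\<lambda>t. t *\<^sub>R (i \<bullet> sgn y))) (at 0)"
            using has_derivative_norm[of y] elim by simp
          then have "((\<lambda>t. norm (y + t *\<^sub>R i)) has_real_derivative (i \<bullet> sgn y)) (at 0)"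
            by (simp add: has_field_derivative_def mult_commute_abs)
          then have "((\<lambda>t. (1 - norm (y + t *\<^sub>R i)) / e) has_real_derivative (- (i \<bullet> sgn y) / e)) (at 0)"
            using e by (auto intro!: derivative_eq_intros)
          from has_vector_derivative_scaleR[OF this der[of y]] 2
          have "(?g has_vector_derivative ((1 - norm y) / e) *\<^sub>R f' y + (- (i \<bullet> sgn y) / e) *\<^sub>R f y) (at 0)"
            by simp
          moreover have "((1 - norm y) / e) *\<^sub>R f' y + (- (i \<bullet> sgn y) / e) *\<^sub>R f y = h' y"
            using 2 e by (auto simp: h'_def min_def field_simps inner_commute)
          ultimately show ?thesis by simp
        qed
        ultimately show ?thesis
          by (subst has_vector_derivative_cong_ev[where g = ?g]) (auto elim: eventually_mono)
      next
        case 3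
        then have "\<forall>\<^sub>F t in nhds 0. y + t *\<^sub>R i \<in> - cball 0 1"
          by (intro near) auto
        then have "\<forall>\<^sub>F t in nhds 0. h (y + t *\<^sub>R i) = 0"
          by eventually_elim (auto simp: h_def)
        moreover have "h' y = 0" "h y = 0"
          using 3 e by (auto simp: h'_def h_def)
        ultimately show ?thesis
          by (subst has_vector_derivative_cong_ev[where g = "\<lambda>t. 0"]) (auto elim: eventually_mono)
      qed
    qed
    \<comment> \<open>A shift shorter than 1 meets the unit ball only from points of norm below 2.
      In the constant, \<open>C / e\<close> is the slope of the cutoff times the bound of
      \<open>f\<close>, and \<open>C'\<close> is the Lipschitz constant of \<open>f\<close> along
      \<open>i\<close>.\<close>
    show "integrable lborel (\<lambda>y::'a. indicator (cball 0 2) y * (C / e + C'))"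
      using emeasure_bounded_finite[OF bounded_cball, of "0::'a" 2]
      by (intro integrable_mult_left integrable_real_indicator) auto
    fix t :: real and y :: 'a assume t: "\<bar>t\<bar> < 1"
    define z where "z = y + t *\<^sub>R i"
    have nz: "norm (z - y) = \<bar>t\<bar>" using ni by (simp add: z_def)
    have tri: "norm y \<le> norm z + \<bar>t\<bar>" "norm z \<le> norm y + \<bar>t\<bar>"
      using nz norm_triangle_ineq2[of y z] norm_triangle_ineq2[of z y] by (auto simp: norm_minus_commute)
    have plip: "\<bar>p z - p y\<bar> \<le> \<bar>t\<bar> / e" using lip[of z y] nz by simp
    \<comment> \<open>When the step crosses the sphere, \<open>p\<close> is zero at the outer
      endpoint, so its Lipschitz bound alone makes it at most \<open>\<bar>t\<bar> / e\<close> at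
      the inner one; \<open>f\<close> is never compared across the sphere.\<close>
    have one: "norm (h z - h y) \<le> \<bar>t\<bar> * (C / e)"
      if "norm y \<ge> 1 \<and> norm z < 1 \<or> norm y < 1 \<and> norm z \<ge> 1"
    proof -
      have *: "\<bar>q\<bar> * norm (f w) \<le> \<bar>t\<bar> * (C / e)" if "\<bar>q\<bar> \<le> \<bar>t\<bar> / e" "norm w < 1" for q w
        using mult_mono[OF that(1) C[of w]] that e C0 C'0 by auto
      show ?thesis
        using that *[of "p z" z] *[of "p y" y] plip p0 by (auto simp: h_def)
    qed
    show "norm (h (y + t *\<^sub>R i) - h y) \<le> \<bar>t\<bar> * (indicator (cball 0 2) y * (C / e + C'))"
    proof (cases "norm y < 1 \<or> norm z < 1")
      case False
      then show ?thesis
        using C0 C'0 e by (auto simp: h_def simp flip: z_def split: split_indicator)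
    next
      case True
      then have ind: "indicator (cball 0 2) y = (1::real)"
        using tri t by (auto simp: indicator_def)
      have Ct: "\<bar>t\<bar> * (C / e) \<le> \<bar>t\<bar> * (C / e + C')" using C0 C'0 by (intro mult_left_mono) auto
      show ?thesis
      proof (cases "norm y < 1 \<and> norm z < 1")
        case False
        with True one Ct ind show ?thesis by (auto simp flip: z_def)
      next
        case both: True
        have "norm (f z - f y) \<le> C' * norm (z - y)"
        proof -
          have seg: "y + s *\<^sub>R i \<in> ball 0 1" if "s \<in> closed_segment 0 t" for s
          proof -
            have "closed_segment y z \<subseteq> ball 0 1"
              using both by (intro closed_segment_subset convex_ball) auto
            moreover have "y + s *\<^sub>R i \<in> closed_segment y z"
              using that unfolding z_def by (auto simp: closed_segment_def algebra_simps)
            ultimately show ?thesis by blast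
          qed
          have "norm (f (y + t *\<^sub>R i) - f (y + 0 *\<^sub>R i)) \<le> C' * norm (t - 0)"
          proof (rule differentiable_bound[where S = "closed_segment 0 t"])
            fix s assume s: "s \<in> closed_segment 0 t"
            have "((\<lambda>h. f (y + h *\<^sub>R i)) has_vector_derivative f' (y + s *\<^sub>R i)) (at s)"
              by (rule has_vector_derivative_along_line[OF der[OF seg[OF s]]])
            then show "((\<lambda>h. f (y + h *\<^sub>R i)) has_derivative (\<lambda>h. h *\<^sub>R f' (y + s *\<^sub>R i))) (at s within closed_segment 0 t)"
              by (simp add: has_vector_derivative_def has_derivative_at_withinI)
            show "onorm (\<lambda>h. h *\<^sub>R f' (y + s *\<^sub>R i)) \<le> C'"
              using C'[of "y + s *\<^sub>R i"] seg[OF s] C0 C'0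
              by (intro onorm_le) (auto simp: mult.commute[of C'] intro!: mult_left_mono)
          qed auto
          then show ?thesis by (simp add: z_def ni)
        qed
        then have fz: "norm (f z - f y) \<le> \<bar>t\<bar> * C'" by (simp add: nz mult.commute)
        have "h z - h y = (p z - p y) *\<^sub>R f z + p y *\<^sub>R (f z - f y)"
          using both by (simp add: h_def algebra_simps)
        also have "norm \<dots> \<le> \<bar>p z - p y\<bar> * norm (f z) + \<bar>p y\<bar> * norm (f z - f y)"
          by (metis norm_triangle_ineq norm_scaleR)
        also have "\<dots> \<le> (\<bar>t\<bar> / e) * C + 1 * (\<bar>t\<bar> * C')"
        proof (rule add_mono)
          show "\<bar>p z - p y\<bar> * norm (f z) \<le> (\<bar>t\<bar> / e) * C"
            using plip C[of z] both e by (intro mult_mono) auto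
          show "\<bar>p y\<bar> * norm (f z - f y) \<le> 1 * (\<bar>t\<bar> * C')"
            using p01[of y] fz by (intro mult_mono) auto
        qed
        also have "\<dots> = \<bar>t\<bar> * (C / e + C')" by (simp add: algebra_simps)
        finally show ?thesis using ind by (simp flip: z_def)
      qed
    qed
  qed
  moreover have "(LINT y|lborel. h' y) = (LINT y:ball 0 1|lborel. min 1 ((1 - norm y) / e) *\<^sub>R f' y) -
      (LINT y:ball 0 1 - cball 0 (1 - e)|lborel. ((sgn y \<bullet> i) *\<^sub>R f y) /\<^sub>R e)"
    using inner_f outer_f' unfolding h'_def set_lebesgue_integral_def set_integrable_def
    by (intro Bochner_Integration.integral_diff)
  ultimately show ?thesis
    by (simp only: set_integral_scaleR_right) simp
qed

text \<open>
  The right-hand side is the surface integral of \<open>n\<^sub>i f\<close> over the unit sphere, with surface measure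
  written as \<open>m\<close> times the image of Lebesgue measure under radial projection.
\<close>

theorem divergence_unit_ball:
  fixes f f' :: "'a::euclidean_space \<Rightarrow> 'b::{banach, second_countable_topology}"
  assumes i: "i \<in> Basis" and f: "continuous_on (cball 0 1) f" and f': "continuous_on (cball 0 1) f'"
    and der: "\<And>y. y \<in> ball 0 1 \<Longrightarrow> ((\<lambda>t. f (y + t *\<^sub>R i)) has_vector_derivative f' y) (at 0)"
  shows "(LINT y:ball 0 1|lborel. f' y) =
    real DIM('a) *\<^sub>R (LINT y:ball 0 1|lborel. (sgn y \<bullet> i) *\<^sub>R f (sgn y))"
proof -
  define m where "m = DIM('a)"
  define V where "V = measure lborel (ball (0::'a) 1)"
  define g where "g y = (sgn y \<bullet> i) *\<^sub>R f (sgn y)" for y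
  define I where "I = (LINT y:ball 0 1|lborel. g y)"
  define L where "L e = (LINT y:ball 0 1|lborel. min 1 ((1 - norm y) / e) *\<^sub>R f' y)" for e
  have V: "measure lborel (ball (0::'a) s) = V * s ^ m" if "s > 0" for s
    using that by (simp add: V_def m_def content_ball)
  have g_meas: "g \<in> borel_measurable borel" and g_int: "set_integrable lborel (ball 0 1) g"
    using radial_projection_integrable[OF f, of i] by (auto simp: g_def[abs_def])
  \<comment> \<open>On the shell, \<open>f y\<close> is replaced by \<open>f (sgn y)\<close> at the
    cost of at most \<open>d\<close> per unit volume. The replaced integral is exactly
    \<open>(1 - (1 - e) ^ m) *\<^sub>R I\<close>, and the shell has volume
    \<open>V * (1 - (1 - e) ^ m)\<close>, at most \<open>V * m * e\<close> by Bernoulli, so dividing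
    by \<open>e\<close> leaves a bounded error.\<close>
  have shell_error: "norm (L e - ((1 - (1 - e) ^ m) / e) *\<^sub>R I) \<le> real m * V * d"
    if e: "0 < e" "e < 1" and d: "d \<ge> 0"
      and close: "\<And>y z. y \<in> cball 0 1 \<Longrightarrow> z \<in> cball 0 1 \<Longrightarrow> dist y z \<le> e \<Longrightarrow> dist (f y) (f z) \<le> d" for e d
  proof -
    define S where "S = ball (0::'a) 1 - cball 0 (1 - e)"
    have S: "S \<in> sets lborel" "S \<subseteq> ball 0 1" by (auto simp: S_def)
    have shell: "(LINT y:S|lborel. k y) = (LINT y:ball 0 1|lborel. k y) - (LINT y:ball 0 (1 - e)|lborel. k y)"
      if "set_integrable lborel (ball 0 1) k" for k :: "'a \<Rightarrow> 'c::{banach, second_countable_topology}"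
    proof -
      have "(LINT y:ball 0 1|lborel. k y) = (LINT y:cball 0 (1 - e) \<union> S|lborel. k y)"
        using e by (intro arg_cong[where f = "\<lambda>A. set_lebesgue_integral lborel A k"]) (auto simp: S_def)
      also have "\<dots> = (LINT y:cball 0 (1 - e)|lborel. k y) + (LINT y:S|lborel. k y)"
        by (intro set_integral_Un set_integrable_subset[OF that]) (use e in \<open>auto simp: S_def\<close>)
      also have "(LINT y:cball 0 (1 - e)|lborel. k y) = (LINT y:ball 0 (1 - e)|lborel. k y)"
      proof (rule set_integral_cong_set)
        show "set_borel_measurable lborel (cball 0 (1 - e)) k" "set_borel_measurable lborel (ball 0 (1 - e)) k"
          unfolding set_borel_measurable_def
          by (intro borel_measurable_integrable set_integrable_subset[OF that, unfolded set_integrable_def];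
              use e in auto)+
        show "AE y in lborel. (y \<in> ball 0 (1 - e)) = (y \<in> cball 0 (1 - e))"
          by (rule AE_mp[OF AE_not_in[OF null_sets_sphere[of 0 "1 - e"]]]) auto
      qed
      finally show ?thesis by simp
    qed
    have Ig: "(LINT y:S|lborel. g y) = (1 - (1 - e) ^ m) *\<^sub>R I"
      using shell[OF g_int] integral_radial_projection_ball[of "1 - e" "\<lambda>y. (y \<bullet> i) *\<^sub>R f y"] g_meas e
      by (simp add: I_def m_def g_def[abs_def] scaleR_diff_left)
    have f_int: "set_integrable lborel S (\<lambda>y. (sgn y \<bullet> i) *\<^sub>R f y)"
    proof -
      have "continuous_on (cball 0 1 - ball 0 (1 - e)) (\<lambda>y. (sgn y \<bullet> i) *\<^sub>R f y)"
        by (intro continuous_intros continuous_on_subset[OF f]) (use e in auto)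
      then have "set_integrable lborel (cball 0 1 - ball 0 (1 - e)) (\<lambda>y. (sgn y \<bullet> i) *\<^sub>R f y)"
        unfolding set_integrable_def by (intro borel_integrable_compact compact_diff) auto
      then show ?thesis
        by (rule set_integrable_subset) (auto simp: S_def)
    qed
    have diff_int: "set_integrable lborel S (\<lambda>y. (sgn y \<bullet> i) *\<^sub>R f y - g y)"
      using f_int set_integrable_subset[OF g_int S] by (rule set_integral_diff)
    have bound: "norm ((sgn y \<bullet> i) *\<^sub>R f y - g y) \<le> d" if "y \<in> S" for y
    proof -
      have y: "1 - e < norm y" "norm y < 1" using that by (auto simp: S_def)
      have "norm y *\<^sub>R sgn y = y" by (cases "y = 0") (auto simp: sgn_div_norm)
      then have "y - sgn y = (norm y - 1) *\<^sub>R sgn y" by (simp add: scaleR_diff_left)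
      then have "norm (y - sgn y) \<le> e" using y by (simp add: norm_sgn)
      then have "dist (f y) (f (sgn y)) \<le> d"
        using y by (intro close) (auto simp: norm_sgn dist_norm)
      moreover have "\<bar>sgn y \<bullet> i\<bar> \<le> 1"
        using Cauchy_Schwarz_ineq2[of "sgn y" i] i by (auto simp: norm_sgn split: if_splits)
      ultimately have "\<bar>sgn y \<bullet> i\<bar> * norm (f y - f (sgn y)) \<le> 1 * d"
        using d by (intro mult_mono) (auto simp: dist_norm)
      then show ?thesis by (simp add: g_def flip: scaleR_diff_right)
    qed
    have "L e - ((1 - (1 - e) ^ m) / e) *\<^sub>R I = (LINT y:S|lborel. (sgn y \<bullet> i) *\<^sub>R f y - g y) /\<^sub>R e"
      using divergence_unit_ball_cutoff[OF i f f' der e] f_int set_integrable_subset[OF g_int S] Ig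
      by (simp add: L_def S_def set_integral_diff scaleR_diff_right divide_inverse_commute)
    also have "norm \<dots> \<le> (LINT y:S|lborel. d) / e"
    proof -
      have "norm (LINT y:S|lborel. (sgn y \<bullet> i) *\<^sub>R f y - g y) \<le> (LINT y:S|lborel. d)"
        unfolding set_lebesgue_integral_def
      proof (rule Bochner_Integration.integral_norm_bound_integral)
        show "integrable lborel (\<lambda>y. indicator S y *\<^sub>R d)"
          using set_integrable_subset[OF set_integrable_unit_ball[of "\<lambda>_. d"] S] by (simp add: set_integrable_def)
      qed (use bound diff_int in \<open>auto simp: set_integrable_def split: split_indicator\<close>)
      then show ?thesis using e by (simp add: divide_inverse_commute)
    qed
    also have "(LINT y:S|lborel. d) = V * (1 - (1 - e) ^ m) * d"
      using shell[OF set_integrable_unit_ball[of "\<lambda>_. d"]] V[of "1 - e"] e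
      by (simp add: set_lebesgue_integral_def V_def algebra_simps)
    also have "\<dots> / e \<le> real m * V * d"
    proof -
      have "1 - real m * e \<le> (1 - e) ^ m"
        using Bernoulli_inequality[of "- e" m] e by simp
      then have "1 - (1 - e) ^ m \<le> real m * e" by simp
      then have "(1 - (1 - e) ^ m) * (V * d) \<le> real m * e * (V * d)"
        using d by (intro mult_right_mono) (auto simp: V_def)
      then show ?thesis using e by (simp add: field_simps)
    qed
    finally show ?thesis .
  qed
  \<comment> \<open>Two successors, so that already \<open>e 0 < 1\<close>.\<close>
  define e :: "nat \<Rightarrow> real" where "e n = inverse (real (Suc (Suc n)))" for n
  have e: "0 < e n" "e n < 1" for n by (auto simp: e_def field_simps)
  have e0: "e \<longlonglongrightarrow> 0"
    unfolding e_def by (rule LIMSEQ_Suc[OF LIMSEQ_inverse_real_of_nat])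
  have "(\<lambda>n. L (e n)) \<longlonglongrightarrow> (LINT y:ball 0 1|lborel. f' y)"
    unfolding L_def set_lebesgue_integral_def
  proof (rule integral_dominated_convergence[where w = "\<lambda>y. indicator (ball 0 1) y * norm (f' y)"])
    have f'_int: "set_integrable lborel (ball 0 1) f'"
      by (rule set_integrable_unit_ball[OF f'])
    then show "(\<lambda>y. indicat_real (ball 0 1) y *\<^sub>R f' y) \<in> borel_measurable lborel"
      by (auto simp: set_integrable_def)
    show "integrable lborel (\<lambda>y. indicator (ball 0 1) y * norm (f' y))"
      using set_integrable_unit_ball[of "\<lambda>y. norm (f' y)"] f' by (auto simp: set_integrable_def intro: continuous_intros)
    show "(\<lambda>y. indicat_real (ball 0 1) y *\<^sub>R min 1 ((1 - norm y) / e n) *\<^sub>R f' y) \<in> borel_measurable lborel" for n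
      by (rule borel_measurable_integrable, rule set_integrable_unit_ball[unfolded set_integrable_def])
        (intro continuous_intros f', use e[of n] in auto)
    show "AE y in lborel. (\<lambda>n. indicat_real (ball 0 1) y *\<^sub>R min 1 ((1 - norm y) / e n) *\<^sub>R f' y)
        \<longlonglongrightarrow> indicat_real (ball 0 1) y *\<^sub>R f' y"
    proof (intro AE_I2 tendsto_eventually)
      fix y :: 'a
      show "\<forall>\<^sub>F n in sequentially. indicat_real (ball 0 1) y *\<^sub>R min 1 ((1 - norm y) / e n) *\<^sub>R f' y =
          indicat_real (ball 0 1) y *\<^sub>R f' y"
      proof (cases "norm y < 1")
        case True
        then have "\<forall>\<^sub>F n in sequentially. e n < 1 - norm y"
          using e0 by (intro order_tendstoD) auto
        then show ?thesis
          by eventually_elim (use e in \<open>auto simp: min_def field_simps\<close>)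
      qed auto
    qed
    show "AE y in lborel. norm (indicat_real (ball 0 1) y *\<^sub>R min 1 ((1 - norm y) / e n) *\<^sub>R f' y)
        \<le> indicat_real (ball 0 1) y * norm (f' y)" for n
    proof (intro AE_I2)
      fix y :: 'a
      have "\<bar>min 1 ((1 - norm y) / e n)\<bar> \<le> 1" if "norm y < 1"
        using that e[of n] by (auto simp: min_def)
      then show "norm (indicat_real (ball 0 1) y *\<^sub>R min 1 ((1 - norm y) / e n) *\<^sub>R f' y)
          \<le> indicat_real (ball 0 1) y * norm (f' y)"
        by (auto split: split_indicator intro: mult_left_le_one_le)
    qed
  qed
  moreover have "(\<lambda>n. L (e n)) \<longlonglongrightarrow> real m *\<^sub>R I"
  proof -
    have "(\<lambda>n. L (e n) - ((1 - (1 - e n) ^ m) / e n) *\<^sub>R I) \<longlonglongrightarrow> 0"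
    proof (rule LIMSEQ_I)
      fix \<epsilon> :: real assume eps: "\<epsilon> > 0"
      define K where "K = real m * V"
      \<comment> \<open>The \<open>+ 1\<close> keeps the denominator positive from
        \<open>K \<ge> 0\<close> alone and still gives \<open>K * d < \<epsilon>\<close>.\<close>
      define d where "d = \<epsilon> / (2 * (K + 1))"
      have K: "K \<ge> 0" by (simp add: K_def V_def)
      have d: "d > 0" using eps K by (simp add: d_def)
      have "d * (2 * (K + 1)) = \<epsilon>"
        using K by (simp add: d_def)
      then have "\<epsilon> = K * d + (K + 2) * d"
        by (simp add: algebra_simps)
      moreover have "(K + 2) * d > 0" using K d by (intro mult_pos_pos) auto
      ultimately have small: "real m * V * d < \<epsilon>" unfolding K_def by linarith
      have "uniformly_continuous_on (cball 0 1) f"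
        using f by (intro compact_uniformly_continuous) auto
      then obtain r where r: "r > 0"
        "\<And>y z. y \<in> cball 0 1 \<Longrightarrow> z \<in> cball 0 1 \<Longrightarrow> dist y z < r \<Longrightarrow> dist (f y) (f z) < d"
        unfolding uniformly_continuous_on_def using d by metis
      have "\<forall>\<^sub>F n in sequentially. e n < r"
        using e0 r(1) by (intro order_tendstoD) auto
      then have "\<forall>\<^sub>F n in sequentially. norm (L (e n) - ((1 - (1 - e n) ^ m) / e n) *\<^sub>R I - 0) < \<epsilon>"
      proof eventually_elim
        case (elim n)
        have "norm (L (e n) - ((1 - (1 - e n) ^ m) / e n) *\<^sub>R I) \<le> real m * V * d"
          using e d r(2) elim by (intro shell_error) (auto intro!: less_imp_le r(2) simp del: mem_cball)
        then show ?case using small by simp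
      qed
      then show "\<exists>N. \<forall>n\<ge>N. norm (L (e n) - ((1 - (1 - e n) ^ m) / e n) *\<^sub>R I - 0) < \<epsilon>"
        by (simp add: eventually_sequentially)
    qed
    \<comment> \<open>The limit is minus the derivative of \<open>(1 - x) ^ m\<close> at 0; this is
      the source of the factor \<open>DIM('a)\<close> in the boundary term.\<close>
    moreover have "(\<lambda>n. (1 - (1 - e n) ^ m) / e n) \<longlonglongrightarrow> real m"
    proof -
      have "((\<lambda>x::real. (1 - x) ^ m) has_real_derivative - real m) (at 0)"
        by (auto intro!: derivative_eq_intros)
      then have "((\<lambda>x::real. ((1 - x) ^ m - 1) / x) \<longlongrightarrow> - real m) (at 0)"
        by (simp add: has_field_derivative_iff)
      then have "((\<lambda>x::real. (1 - (1 - x) ^ m) / x) \<longlongrightarrow> real m) (at 0)"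
        by (rule tendsto_minus_cancel[OF tendsto_cong[THEN iffD1, rotated]]) (simp add: divide_simps)
      then show ?thesis
        using e0 e unfolding tendsto_at_iff_sequentially comp_def by (auto simp: less_imp_neq[symmetric])
    qed
    ultimately show ?thesis
      using tendsto_add[OF _ tendsto_scaleR[OF _ tendsto_const[of I]], of _ 0 sequentially _ "real m"] by fastforce
  qed
  ultimately show ?thesis
    unfolding I_def g_def m_def by (rule LIMSEQ_unique)
qed

corollary integral_partial_derivative_unit_ball_eq_0:
  fixes f f' :: "'a::euclidean_space \<Rightarrow> 'b::{banach, second_countable_topology}"
  assumes "i \<in> Basis" "continuous_on (cball 0 1) f" "continuous_on (cball 0 1) f'"
    and "\<And>y. y \<in> ball 0 1 \<Longrightarrow> ((\<lambda>t. f (y + t *\<^sub>R i)) has_vector_derivative f' y) (at 0)"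
    and zero: "\<And>y. norm y = 1 \<Longrightarrow> f y = 0"
  shows "(LINT y:ball 0 1|lborel. f' y) = 0"
proof -
  have "(\<lambda>y. (sgn y \<bullet> i) *\<^sub>R f (sgn y)) = (\<lambda>y. 0)"
    using zero[of "sgn _"] by (intro ext) (metis inner_zero_left norm_sgn scaleR_eq_0_iff sgn_zero)
  then show ?thesis
    using divergence_unit_ball[OF assms(1-4)] by simp
qed

section \<open>Weighted ball means\<close>

lemma weight_has_derivative:
  fixes y i :: "'a::real_inner"
  shows "((\<lambda>t. (1 - (y + t *\<^sub>R i) \<bullet> (y + t *\<^sub>R i)) ^ Suc k) has_real_derivative
    - (2 * real (Suc k) * (y \<bullet> i) * (1 - y \<bullet> y) ^ k)) (at 0)"
proof -
  have *: "(y + t *\<^sub>R i) \<bullet> (y + t *\<^sub>R i) = y \<bullet> y + 2 * t * (y \<bullet> i) + t\<^sup>2 * (i \<bullet> i)" for t :: real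
    by (simp add: inner_add_left inner_add_right inner_commute power2_eq_square algebra_simps)
  show ?thesis
    unfolding * by (rule derivative_eq_intros refl | simp)+
qed

text \<open>The product of \<open>G\<close> and the weight with exponent \<open>Suc k\<close> has
  zero boundary values, so its partial derivative integrates to 0; the product rule then gives the
  two sides. The exponent must be positive, since with exponent 0 a boundary term would
  remain.\<close>

lemma integral_weighted_partial_derivative:
  fixes G H :: "'a::euclidean_space \<Rightarrow> 'b::{banach, second_countable_topology}"
  assumes i: "i \<in> Basis" and G: "continuous_on (cball 0 1) G" and H: "continuous_on (cball 0 1) H"
    and der: "\<And>y. y \<in> ball 0 1 \<Longrightarrow> ((\<lambda>t. G (y + t *\<^sub>R i)) has_vector_derivative H y) (at 0)"
  shows "(LINT y:ball 0 1|lborel. (1 - y \<bullet> y) ^ Suc k *\<^sub>R H y) =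
    (2 * real (Suc k)) *\<^sub>R (LINT y:ball 0 1|lborel. ((1 - y \<bullet> y) ^ k * (y \<bullet> i)) *\<^sub>R G y)"
proof -
  have eq: "(- (2 * real (Suc k) * (y \<bullet> i) * (1 - y \<bullet> y) ^ k)) *\<^sub>R G y =
      - ((2 * real (Suc k)) *\<^sub>R (((1 - y \<bullet> y) ^ k * (y \<bullet> i)) *\<^sub>R G y))" for y
    by (simp add: algebra_simps)
  have "(LINT y:ball 0 1|lborel. (1 - y \<bullet> y) ^ Suc k *\<^sub>R H y +
      (- (2 * real (Suc k) * (y \<bullet> i) * (1 - y \<bullet> y) ^ k)) *\<^sub>R G y) = 0"
  proof (rule integral_partial_derivative_unit_ball_eq_0[OF i])
    show "continuous_on (cball 0 1) (\<lambda>y. (1 - y \<bullet> y) ^ Suc k *\<^sub>R G y)"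
      by (intro continuous_intros G)
    show "continuous_on (cball 0 1) (\<lambda>y. (1 - y \<bullet> y) ^ Suc k *\<^sub>R H y +
        (- (2 * real (Suc k) * (y \<bullet> i) * (1 - y \<bullet> y) ^ k)) *\<^sub>R G y)"
      by (intro continuous_intros G H)
    show "((\<lambda>t. (1 - (y + t *\<^sub>R i) \<bullet> (y + t *\<^sub>R i)) ^ Suc k *\<^sub>R G (y + t *\<^sub>R i)) has_vector_derivative
        (1 - y \<bullet> y) ^ Suc k *\<^sub>R H y + (- (2 * real (Suc k) * (y \<bullet> i) * (1 - y \<bullet> y) ^ k)) *\<^sub>R G y) (at 0)"
      if "y \<in> ball 0 1" for y
      using has_vector_derivative_scaleR[OF weight_has_derivative[of y i k] der[OF that]] by simp
  qed (simp add: dot_square_norm)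
  then have "(LINT y:ball 0 1|lborel. (1 - y \<bullet> y) ^ Suc k *\<^sub>R H y -
      (2 * real (Suc k)) *\<^sub>R (((1 - y \<bullet> y) ^ k * (y \<bullet> i)) *\<^sub>R G y)) = 0"
    by (simp only: eq add_uminus_conv_diff)
  also have "(LINT y:ball 0 1|lborel. (1 - y \<bullet> y) ^ Suc k *\<^sub>R H y -
      (2 * real (Suc k)) *\<^sub>R (((1 - y \<bullet> y) ^ k * (y \<bullet> i)) *\<^sub>R G y)) =
      (LINT y:ball 0 1|lborel. (1 - y \<bullet> y) ^ Suc k *\<^sub>R H y) -
      (LINT y:ball 0 1|lborel. (2 * real (Suc k)) *\<^sub>R (((1 - y \<bullet> y) ^ k * (y \<bullet> i)) *\<^sub>R G y))"
    by (intro set_integral_diff set_integrable_unit_ball continuous_intros G H)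
  finally show ?thesis
    by (simp only: set_integral_scaleR_right) simp
qed

lemma set_integral_sum:
  fixes f :: "'i \<Rightarrow> 'a \<Rightarrow> 'b::{banach, second_countable_topology}"
  assumes "\<And>i. i \<in> I \<Longrightarrow> set_integrable M A (f i)"
  shows "(LINT x:A|M. (\<Sum>i\<in>I. f i x)) = (\<Sum>i\<in>I. LINT x:A|M. f i x)"
  using assms unfolding set_lebesgue_integral_def set_integrable_def
  by (simp add: scaleR_sum_right Bochner_Integration.integral_sum)

text \<open>Integrating the coordinate functions by parts and summing over the basis gives
  \<open>m * I (Suc k) = 2 * (k + 1) * (I k - I (Suc k))\<close>, because |y|^2 = 1 - (1 - |y|^2).
  Solved for \<open>I (Suc k)\<close>, this is the Gamma recursion; the volume of the ball starts
  it.\<close>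

lemma integral_weight_unit_ball:
  "(LINT y:ball (0::'a::euclidean_space) 1|lborel. (1 - y \<bullet> y) ^ k) =
    pi powr (real DIM('a) / 2) * fact k / Gamma (real k + real DIM('a) / 2 + 1)"
proof (induction k)
  case 0
  have "(LINT y:ball (0::'a) 1|lborel. (1 - y \<bullet> y) ^ 0) = measure lborel (ball (0::'a) 1)"
    by (simp add: set_lebesgue_integral_def)
  then show ?case
    by (simp add: content_ball unit_ball_vol_def)
next
  case (Suc k)
  define I where "I k = (LINT y:ball (0::'a) 1|lborel. (1 - y \<bullet> y) ^ k)" for k
  define m where "m = real DIM('a)"
  have "I (Suc k) = 2 * real (Suc k) * (LINT y:ball (0::'a) 1|lborel. (1 - y \<bullet> y) ^ k * (y \<bullet> i) ^ 2)"
    if i: "i \<in> Basis" for i :: 'a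
  proof -
    have "I (Suc k) = (LINT y:ball (0::'a) 1|lborel. (1 - y \<bullet> y) ^ Suc k *\<^sub>R 1)"
      by (simp add: I_def)
    also have "\<dots> = (2 * real (Suc k)) *\<^sub>R
        (LINT y:ball (0::'a) 1|lborel. ((1 - y \<bullet> y) ^ k * (y \<bullet> i)) *\<^sub>R (y \<bullet> i))"
      by (rule integral_weighted_partial_derivative[OF i])
        (use i in \<open>auto intro!: continuous_intros derivative_eq_intros simp: inner_add_left\<close>)
    finally show ?thesis
      by (simp add: power2_eq_square mult.assoc)
  qed
  then have "(\<Sum>i\<in>(Basis::'a set). I (Suc k)) =
      (\<Sum>i\<in>Basis. 2 * real (Suc k) * (LINT y:ball (0::'a) 1|lborel. (1 - y \<bullet> y) ^ k * (y \<bullet> i) ^ 2))"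
    by (rule sum.cong[OF refl])
  then have "m * I (Suc k) = 2 * real (Suc k) *
      (\<Sum>i\<in>Basis. LINT y:ball (0::'a) 1|lborel. (1 - y \<bullet> y) ^ k * (y \<bullet> i) ^ 2)"
    by (simp add: m_def sum_distrib_left)
  also have "(\<Sum>i\<in>Basis. LINT y:ball (0::'a) 1|lborel. (1 - y \<bullet> y) ^ k * (y \<bullet> i) ^ 2) =
      (LINT y:ball (0::'a) 1|lborel. (\<Sum>i\<in>Basis. (1 - y \<bullet> y) ^ k * (y \<bullet> i) ^ 2))"
    by (rule set_integral_sum[symmetric]) (auto intro!: set_integrable_unit_ball continuous_intros)
  also have "\<dots> = (LINT y:ball (0::'a) 1|lborel. (1 - y \<bullet> y) ^ k - (1 - y \<bullet> y) ^ Suc k)"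
  proof -
    have "(\<Sum>i\<in>Basis. (y \<bullet> i) ^ 2) = y \<bullet> y" for y :: 'a
      by (simp add: euclidean_inner[of y y] power2_eq_square)
    then have "(\<Sum>i\<in>Basis. (1 - y \<bullet> y) ^ k * (y \<bullet> i) ^ 2) = (1 - y \<bullet> y) ^ k - (1 - y \<bullet> y) ^ Suc k" for y :: 'a
      unfolding sum_distrib_left[symmetric] by (simp add: algebra_simps)
    then show ?thesis by simp
  qed
  also have "\<dots> = I k - I (Suc k)"
    unfolding I_def by (intro set_integral_diff set_integrable_unit_ball continuous_intros)
  finally have "(real k + m / 2 + 1) * I (Suc k) = real (Suc k) * I k"
    by (simp add: algebra_simps)
  moreover have "real k + m / 2 + 1 > 0"
    by (simp add: m_def add_nonneg_pos)
  ultimately have "I (Suc k) = real (Suc k) * I k / (real k + m / 2 + 1)"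
    by (simp add: field_simps)
  moreover have "real k + m / 2 + 1 \<notin> \<int>\<^sub>\<le>\<^sub>0"
    using \<open>real k + m / 2 + 1 > 0\<close> nonpos_Ints_nonpos by (meson not_le)
  then have "Gamma (real (Suc k) + m / 2 + 1) = (real k + m / 2 + 1) * Gamma (real k + m / 2 + 1)"
    using Gamma_plus1[of "real k + m / 2 + 1"] by (simp add: algebra_simps)
  ultimately show ?case
    using Suc.IH unfolding I_def m_def by (simp add: ac_simps)
qed

text \<open>\<open>G i\<close> and \<open>H i\<close> stand for the first and pure second partial
  derivatives of \<open>v\<close>, continuous up to the sphere. Derivatives are taken within
  \<open>{0..1}\<close> because \<open>v (t *\<^sub>R y)\<close> is controlled only while the scaled
  point stays in the closed ball.\<close>

lemma weighted_ball_mean_has_derivative: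
  fixes v :: "'a::euclidean_space \<Rightarrow> complex"
  assumes v: "continuous_on (cball 0 1) v"
    and v': "\<And>y. y \<in> ball 0 1 \<Longrightarrow> (v has_derivative (\<lambda>h. \<Sum>i\<in>Basis. (h \<bullet> i) *\<^sub>R G i y)) (at y)"
    and G: "\<And>i. i \<in> Basis \<Longrightarrow> continuous_on (cball 0 1) (G i)"
    and H: "\<And>i. i \<in> Basis \<Longrightarrow> continuous_on (cball 0 1) (H i)"
    and G': "\<And>i y. i \<in> Basis \<Longrightarrow> y \<in> ball 0 1 \<Longrightarrow>
      ((\<lambda>t. G i (y + t *\<^sub>R i)) has_vector_derivative H i y) (at 0)"
    and lap: "\<And>y. y \<in> ball 0 1 \<Longrightarrow> (\<Sum>i\<in>Basis. H i y) = c * v y"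
    and s: "s \<in> {0..1}"
  shows "((\<lambda>t. LINT y:ball 0 1|lborel. (1 - y \<bullet> y) ^ k *\<^sub>R v (t *\<^sub>R y)) has_vector_derivative
    c * of_real (s / (2 * real (Suc k))) * (LINT y:ball 0 1|lborel. (1 - y \<bullet> y) ^ Suc k *\<^sub>R v (s *\<^sub>R y)))
    (at s within {0..1})"
proof -
  have scaled: "t *\<^sub>R y \<in> cball 0 1" if "t \<in> {0..1}" "y \<in> cball 0 1" for t and y :: 'a
    using that by (auto intro: mult_le_one)
  have scaled_ball: "t *\<^sub>R y \<in> ball 0 1" if "t \<in> {0..1}" "y \<in> ball 0 1" for t and y :: 'a
    using that mult_left_le_one_le[of "norm y" t] by auto
  have cont: "continuous_on (cball 0 1) (\<lambda>y. f (t *\<^sub>R y))"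
    if "continuous_on (cball 0 1) f" "t \<in> {0..1}" for f :: "'a \<Rightarrow> complex" and t
    by (rule continuous_on_compose2[OF that(1)]) (use scaled that in \<open>auto intro!: continuous_intros\<close>)
  define d where "d t y = (\<Sum>i\<in>Basis. (y \<bullet> i) *\<^sub>R G i (t *\<^sub>R y))" for t and y :: 'a
  have radial: "((\<lambda>t. v (t *\<^sub>R y)) has_vector_derivative d t y) (at t within S)"
    if "t \<in> {0..1}" "y \<in> ball 0 1" for t y S
  proof -
    have "((\<lambda>t. t *\<^sub>R y) has_derivative (\<lambda>h. h *\<^sub>R y)) (at t)"
      by (auto intro!: derivative_eq_intros)
    from has_derivative_compose[OF this v'[OF scaled_ball[OF that]]]
    have "((\<lambda>t. v (t *\<^sub>R y)) has_derivative (\<lambda>h. h *\<^sub>R d t y)) (at t)"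
      by (simp add: d_def scaleR_sum_right)
    then show ?thesis
      by (simp add: has_vector_derivative_def has_derivative_at_withinI)
  qed
  have "\<forall>i\<in>Basis. \<exists>C. \<forall>y\<in>cball 0 1. norm (G i y) \<le> C"
    using continuous_on_compact_bound[OF compact_cball G] by metis
  then obtain C where C: "\<And>i y. i \<in> Basis \<Longrightarrow> y \<in> cball 0 1 \<Longrightarrow> norm (G i y) \<le> C i"
    by metis
  \<comment> \<open>Since \<open>\<bar>y \<bullet> i\<bar> \<le> 1\<close> in the ball, the bounds
    of the partials add up to a Lipschitz constant of \<open>v (t *\<^sub>R y)\<close> in
    \<open>t\<close>, uniform in \<open>y\<close>.\<close>
  define K where "K = (\<Sum>i\<in>(Basis::'a set). C i)"
  have d_le: "norm (d t y) \<le> K" if "t \<in> {0..1}" "y \<in> ball 0 1" for t y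
    unfolding d_def K_def
  proof (rule sum_norm_le)
    fix i :: 'a assume i: "i \<in> Basis"
    have "\<bar>y \<bullet> i\<bar> \<le> 1" using Basis_le_norm[OF i, of y] that by auto
    moreover have "norm (G i (t *\<^sub>R y)) \<le> C i"
      using C[OF i] scaled_ball[OF that] by auto
    ultimately show "norm ((y \<bullet> i) *\<^sub>R G i (t *\<^sub>R y)) \<le> C i"
      using mult_mono[of "\<bar>y \<bullet> i\<bar>" 1 "norm (G i (t *\<^sub>R y))" "C i"] by simp
  qed
  have w: "\<bar>(1 - y \<bullet> y) ^ k\<bar> \<le> 1" if "y \<in> ball 0 1" for y :: 'a
  proof -
    have "y \<bullet> y \<le> 1" using that by (simp add: dot_square_norm abs_square_le_1)
    then show ?thesis by (simp add: power_abs power_le_one)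
  qed
  have d_cont: "continuous_on (cball 0 1) (d s)"
    unfolding d_def by (intro continuous_intros cont G s)
  have "((\<lambda>t. LINT y:ball 0 1|lborel. (1 - y \<bullet> y) ^ k *\<^sub>R v (t *\<^sub>R y)) has_vector_derivative
      (LINT y:ball 0 1|lborel. (1 - y \<bullet> y) ^ k *\<^sub>R d s y)) (at s within {0..1})"
    unfolding set_lebesgue_integral_def
  proof (rule has_vector_derivative_lebesgue_integral[where d = 1 and K = "\<lambda>y. indicator (ball 0 1) y * K"])
    show "integrable lborel (\<lambda>y. indicator (ball 0 1) y *\<^sub>R (1 - y \<bullet> y) ^ k *\<^sub>R v (t *\<^sub>R y))"
      if "t \<in> {0..1}" for t
      using that by (intro set_integrable_unit_ball[unfolded set_integrable_def] continuous_intros cont v)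
    show "(\<lambda>y. indicat_real (ball 0 1) y *\<^sub>R (1 - y \<bullet> y) ^ k *\<^sub>R d s y) \<in> borel_measurable lborel"
      by (intro borel_measurable_integrable set_integrable_unit_ball[unfolded set_integrable_def]
          continuous_intros d_cont)
    show "AE y in lborel. ((\<lambda>t. indicat_real (ball 0 1) y *\<^sub>R (1 - y \<bullet> y) ^ k *\<^sub>R v (t *\<^sub>R y))
        has_vector_derivative indicat_real (ball 0 1) y *\<^sub>R (1 - y \<bullet> y) ^ k *\<^sub>R d s y) (at s within {0..1})"
    proof (intro AE_I2)
      fix y :: 'a
      show "((\<lambda>t. indicat_real (ball 0 1) y *\<^sub>R (1 - y \<bullet> y) ^ k *\<^sub>R v (t *\<^sub>R y))
        has_vector_derivative indicat_real (ball 0 1) y *\<^sub>R (1 - y \<bullet> y) ^ k *\<^sub>R d s y) (at s within {0..1})"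
      proof (cases "y \<in> ball 0 1")
        case True
        from has_vector_derivative_scaleR[OF DERIV_const radial[OF s True]]
        show ?thesis using True by simp
      qed auto
    qed
    show "integrable lborel (\<lambda>y::'a. indicator (ball 0 1) y * K)"
      using set_integrable_unit_ball[of "\<lambda>_::'a. K"] by (simp add: set_integrable_def)
    fix t :: real and y :: 'a assume t: "t \<in> {0..1}"
    show "norm (indicat_real (ball 0 1) y *\<^sub>R (1 - y \<bullet> y) ^ k *\<^sub>R v (t *\<^sub>R y) -
        indicat_real (ball 0 1) y *\<^sub>R (1 - y \<bullet> y) ^ k *\<^sub>R v (s *\<^sub>R y)) \<le> \<bar>t - s\<bar> * (indicator (ball 0 1) y * K)"
    proof (cases "y \<in> ball 0 1")
      case True
      have "norm (v (t *\<^sub>R y) - v (s *\<^sub>R y)) \<le> K * norm (t - s)"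
      proof (rule differentiable_bound[where S = "{0..1}"])
        show "((\<lambda>t. v (t *\<^sub>R y)) has_derivative (\<lambda>h. h *\<^sub>R d t y)) (at t within {0..1})"
          if "t \<in> {0..1}" for t
          using radial[OF that True] by (simp add: has_vector_derivative_def)
        show "onorm (\<lambda>h. h *\<^sub>R d t y) \<le> K" if "t \<in> {0..1}" for t
          using d_le[OF that True] by (intro onorm_le) (auto simp: mult.commute[of K] intro!: mult_left_mono)
      qed (use s t in auto)
      then have "\<bar>(1 - y \<bullet> y) ^ k\<bar> * norm (v (t *\<^sub>R y) - v (s *\<^sub>R y)) \<le> 1 * (\<bar>t - s\<bar> * K)"
        using w[OF True] by (intro mult_mono) (auto simp: mult.commute)
      then show ?thesis
        using True by (simp flip: scaleR_diff_right)
    qed auto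
  qed (use s in auto)
  moreover have "(LINT y:ball 0 1|lborel. (1 - y \<bullet> y) ^ k *\<^sub>R d s y) =
      c * of_real (s / (2 * real (Suc k))) * (LINT y:ball 0 1|lborel. (1 - y \<bullet> y) ^ Suc k *\<^sub>R v (s *\<^sub>R y))"
  proof -
    \<comment> \<open>The chain rule puts a factor \<open>s\<close> in front of
      \<open>H i (s *\<^sub>R y)\<close>; it becomes the \<open>s\<close> in the derivative
      formula.\<close>
    have parts: "(LINT y:ball 0 1|lborel. ((1 - y \<bullet> y) ^ k * (y \<bullet> i)) *\<^sub>R G i (s *\<^sub>R y)) =
        (1 / (2 * real (Suc k))) *\<^sub>R (LINT y:ball 0 1|lborel. (1 - y \<bullet> y) ^ Suc k *\<^sub>R (s *\<^sub>R H i (s *\<^sub>R y)))"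
      if i: "i \<in> Basis" for i
    proof -
      have "((\<lambda>t. G i (s *\<^sub>R (y + t *\<^sub>R i))) has_vector_derivative s *\<^sub>R H i (s *\<^sub>R y)) (at 0)"
        if y: "y \<in> ball 0 1" for y
      proof -
        have "((\<lambda>t. G i (s *\<^sub>R y + t *\<^sub>R i)) \<circ> (\<lambda>t. s * t) has_vector_derivative s *\<^sub>R H i (s *\<^sub>R y)) (at 0)"
          by (rule vector_diff_chain_at)
            (use G'[OF i scaled_ball[OF s y]] in \<open>auto intro!: derivative_eq_intros\<close>)
        then show ?thesis by (simp add: o_def scaleR_add_right)
      qed
      then have "(LINT y:ball 0 1|lborel. (1 - y \<bullet> y) ^ Suc k *\<^sub>R (s *\<^sub>R H i (s *\<^sub>R y))) =
          (2 * real (Suc k)) *\<^sub>R (LINT y:ball 0 1|lborel. ((1 - y \<bullet> y) ^ k * (y \<bullet> i)) *\<^sub>R G i (s *\<^sub>R y))"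
        by (intro integral_weighted_partial_derivative continuous_intros cont G H i s)
      then show ?thesis by (simp del: of_nat_Suc)
    qed
    have "(LINT y:ball 0 1|lborel. (1 - y \<bullet> y) ^ k *\<^sub>R d s y) =
        (LINT y:ball 0 1|lborel. \<Sum>i\<in>Basis. ((1 - y \<bullet> y) ^ k * (y \<bullet> i)) *\<^sub>R G i (s *\<^sub>R y))"
      by (simp add: d_def scaleR_sum_right)
    also have "\<dots> = (\<Sum>i\<in>Basis. LINT y:ball 0 1|lborel. ((1 - y \<bullet> y) ^ k * (y \<bullet> i)) *\<^sub>R G i (s *\<^sub>R y))"
      by (intro set_integral_sum set_integrable_unit_ball continuous_intros cont G s) auto
    also have "\<dots> = (\<Sum>i\<in>Basis. (1 / (2 * real (Suc k))) *\<^sub>R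
        (LINT y:ball 0 1|lborel. (1 - y \<bullet> y) ^ Suc k *\<^sub>R (s *\<^sub>R H i (s *\<^sub>R y))))"
      by (intro sum.cong refl parts)
    also have "\<dots> = (1 / (2 * real (Suc k))) *\<^sub>R
        (LINT y:ball 0 1|lborel. \<Sum>i\<in>Basis. (1 - y \<bullet> y) ^ Suc k *\<^sub>R (s *\<^sub>R H i (s *\<^sub>R y)))"
      by (subst set_integral_sum)
        (auto intro!: set_integrable_unit_ball continuous_intros cont H s simp: scaleR_sum_right)
    also have "(LINT y:ball 0 1|lborel. \<Sum>i\<in>Basis. (1 - y \<bullet> y) ^ Suc k *\<^sub>R (s *\<^sub>R H i (s *\<^sub>R y))) =
        (LINT y:ball 0 1|lborel. (c * of_real s) * ((1 - y \<bullet> y) ^ Suc k *\<^sub>R v (s *\<^sub>R y)))"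
    proof (rule set_lebesgue_integral_cong, simp, intro allI impI)
      fix y :: 'a assume "y \<in> ball 0 1"
      then have "(\<Sum>i\<in>Basis. H i (s *\<^sub>R y)) = c * v (s *\<^sub>R y)"
        by (intro lap scaled_ball s)
      then show "(\<Sum>i\<in>Basis. (1 - y \<bullet> y) ^ Suc k *\<^sub>R (s *\<^sub>R H i (s *\<^sub>R y))) =
          (c * of_real s) * ((1 - y \<bullet> y) ^ Suc k *\<^sub>R v (s *\<^sub>R y))"
        unfolding scaleR_sum_right[symmetric] by (simp add: scaleR_conv_of_real)
    qed
    finally show ?thesis
      by (simp only: set_integral_mult_right) (simp add: scaleR_conv_of_real ac_simps del: power_Suc of_nat_Suc)
  qed
  ultimately show ?thesis by simp
qed

text \<open>The value of \<open>T\<close> at \<open>s = 1\<close> is the integral of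
  \<open>v\<close>, its value at \<open>s = 0\<close> a partial sum of the series. The mean value
  inequality on \<open>{0..1}\<close> bounds their difference by a null sequence.\<close>

lemma integral_unit_ball_metaharmonic:
  fixes v :: "'a::euclidean_space \<Rightarrow> complex"
  assumes v: "continuous_on (cball 0 1) v"
    and v': "\<And>y. y \<in> ball 0 1 \<Longrightarrow> (v has_derivative (\<lambda>h. \<Sum>i\<in>Basis. (h \<bullet> i) *\<^sub>R G i y)) (at y)"
    and G: "\<And>i. i \<in> Basis \<Longrightarrow> continuous_on (cball 0 1) (G i)"
    and H: "\<And>i. i \<in> Basis \<Longrightarrow> continuous_on (cball 0 1) (H i)"
    and G': "\<And>i y. i \<in> Basis \<Longrightarrow> y \<in> ball 0 1 \<Longrightarrow>
      ((\<lambda>t. G i (y + t *\<^sub>R i)) has_vector_derivative H i y) (at 0)"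
    and lap: "\<And>y. y \<in> ball 0 1 \<Longrightarrow> (\<Sum>i\<in>Basis. H i y) = c * v y"
  shows "(LINT y:ball 0 1|lborel. v y) = of_real (pi powr (real DIM('a) / 2)) *
    (\<Sum>k. (c / 4) ^ k / (fact k * Gamma (of_nat k + of_nat DIM('a) / 2 + 1))) * v 0"
proof -
  define a where "a = c / 4"
  define b where "b k s = (LINT y:ball 0 1|lborel. (1 - y \<bullet> y) ^ k *\<^sub>R v (s *\<^sub>R y))" for k s
  \<comment> \<open>\<open>b\<^sub>0\<close> as a function of \<open>s\<^sup>2\<close> has \<open>k\<close>-th derivative \<open>a\<^sup>k / k! b\<^sub>k\<close>, so \<open>T N s\<close> is its Taylor
    polynomial at the point \<open>s\<^sup>2\<close>, evaluated at 1\<close>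
  define T where "T N s = (\<Sum>k<N. (1 - s\<^sup>2) ^ k *\<^sub>R (a ^ k / (fact k)\<^sup>2 * b k s))" for N s
  define q where "q k = a ^ k / (fact k * Gamma (of_nat k + of_nat DIM('a) / 2 + 1))" for k
  have b': "(b k has_vector_derivative 2 * a * of_real s / of_nat (Suc k) * b (Suc k) s) (at s within {0..1})"
    if "s \<in> {0..1}" for k s
    using weighted_ball_mean_has_derivative[OF v v' G H G' lap that, of k]
    by (simp add: b_def[abs_def] a_def field_simps)
  \<comment> \<open>The sum telescopes: differentiating the power of \<open>1 - s\<^sup>2\<close> in
    one term cancels differentiating \<open>b\<close> in the term before. Only the last derivative
    of \<open>b\<close> survives, as in Taylor's formula with a moving centre.\<close>
  have T': "(T (Suc n) has_vector_derivative
      (s * (1 - s\<^sup>2) ^ n) *\<^sub>R (2 * a ^ Suc n / (fact n * fact (Suc n)) * b (Suc n) s)) (at s within {0..1})"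
    if s: "s \<in> {0..1}" for n s
  proof (induction n)
    case 0
    show ?case
      using b'[OF s, of 0] by (simp add: T_def[abs_def] scaleR_conv_of_real ac_simps)
  next
    case (Suc n)
    have w: "((\<lambda>s. (1 - s\<^sup>2) ^ Suc n) has_real_derivative (- (2 * real (Suc n) * s * (1 - s\<^sup>2) ^ n))) (at s within {0..1})"
      by (rule derivative_eq_intros refl | simp)+
    have bk: "((\<lambda>s. a ^ Suc n / (fact (Suc n))\<^sup>2 * b (Suc n) s) has_vector_derivative
        a ^ Suc n / (fact (Suc n))\<^sup>2 * (2 * a * of_real s / of_nat (Suc (Suc n)) * b (Suc (Suc n)) s)) (at s within {0..1})"
      by (intro has_vector_derivative_mult_right b' s)
    have "T (Suc (Suc n)) = (\<lambda>s. T (Suc n) s + (1 - s\<^sup>2) ^ Suc n *\<^sub>R (a ^ Suc n / (fact (Suc n))\<^sup>2 * b (Suc n) s))"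
      by (simp add: T_def fun_eq_iff)
    then have "(T (Suc (Suc n)) has_vector_derivative
        (s * (1 - s\<^sup>2) ^ n) *\<^sub>R (2 * a ^ Suc n / (fact n * fact (Suc n)) * b (Suc n) s) +
        ((1 - s\<^sup>2) ^ Suc n *\<^sub>R (a ^ Suc n / (fact (Suc n))\<^sup>2 *
          (2 * a * of_real s / of_nat (Suc (Suc n)) * b (Suc (Suc n)) s)) +
        (- (2 * real (Suc n) * s * (1 - s\<^sup>2) ^ n)) *\<^sub>R (a ^ Suc n / (fact (Suc n))\<^sup>2 * b (Suc n) s)))
        (at s within {0..1})"
      using has_vector_derivative_add[OF Suc.IH has_vector_derivative_scaleR[OF w bk]] by simp
    moreover have "(s * (1 - s\<^sup>2) ^ n) *\<^sub>R (2 * a ^ Suc n / (fact n * fact (Suc n)) * b (Suc n) s) =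
        (2 * real (Suc n) * s * (1 - s\<^sup>2) ^ n) *\<^sub>R (a ^ Suc n / (fact (Suc n))\<^sup>2 * b (Suc n) s)"
      by (simp add: scaleR_conv_of_real power2_eq_square divide_simps del: of_nat_Suc)
    moreover have "(1 - s\<^sup>2) ^ Suc n *\<^sub>R (a ^ Suc n / (fact (Suc n))\<^sup>2 *
          (2 * a * of_real s / of_nat (Suc (Suc n)) * b (Suc (Suc n)) s)) =
        (s * (1 - s\<^sup>2) ^ Suc n) *\<^sub>R (2 * a ^ Suc (Suc n) / (fact (Suc n) * fact (Suc (Suc n))) * b (Suc (Suc n)) s)"
      by (simp add: scaleR_conv_of_real power2_eq_square divide_simps del: of_nat_Suc)
    ultimately show ?case by simp
  qed
  obtain C where C: "\<And>y. y \<in> cball 0 1 \<Longrightarrow> norm (v y) \<le> C"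
    using continuous_on_compact_bound[OF compact_cball v] by blast
  define K where "K = measure lborel (ball (0::'a) 1) * C"
  have b_le: "norm (b k s) \<le> K" if s: "s \<in> {0..1}" for k s
  proof -
    have "norm (b k s) \<le> (LINT y:ball (0::'a) 1|lborel. C)"
      unfolding b_def set_lebesgue_integral_def
    proof (rule Bochner_Integration.integral_norm_bound_integral)
      have "continuous_on (cball 0 1) (\<lambda>y. v (s *\<^sub>R y))"
        by (rule continuous_on_compose2[OF v]) (use s in \<open>auto intro!: continuous_intros mult_le_one\<close>)
      then show "integrable lborel (\<lambda>y. indicator (ball 0 1) y *\<^sub>R (1 - y \<bullet> y) ^ k *\<^sub>R v (s *\<^sub>R y))"
        by (intro set_integrable_unit_ball[unfolded set_integrable_def] continuous_intros)
      show "integrable lborel (\<lambda>y::'a. indicator (ball 0 1) y *\<^sub>R C)"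
        using set_integrable_unit_ball[of "\<lambda>_::'a. C"] by (simp add: set_integrable_def)
      fix y :: 'a
      show "norm (indicat_real (ball 0 1) y *\<^sub>R (1 - y \<bullet> y) ^ k *\<^sub>R v (s *\<^sub>R y)) \<le> indicator (ball 0 1) y *\<^sub>R C"
      proof (cases "y \<in> ball 0 1")
        case True
        then have "y \<bullet> y \<le> 1" by (simp add: dot_square_norm abs_square_le_1)
        then have "\<bar>(1 - y \<bullet> y) ^ k\<bar> \<le> 1" by (simp add: power_abs power_le_one)
        moreover have "norm (v (s *\<^sub>R y)) \<le> C"
          using True s by (intro C) (auto intro: mult_le_one)
        ultimately show ?thesis
          using True mult_mono[of "\<bar>(1 - y \<bullet> y) ^ k\<bar>" 1 "norm (v (s *\<^sub>R y))" C] by simp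
      qed auto
    qed
    then show ?thesis by (simp add: K_def set_lebesgue_integral_def)
  qed
  \<comment> \<open>In the formula for the derivative, \<open>s * (1 - s\<^sup>2) ^ n\<close> and
    \<open>1 / fact (Suc n)\<close> are at most 1 and \<open>b\<close> is at most \<open>K\<close>;
    the remaining \<open>1 / fact n\<close> suffices for convergence to 0.\<close>
  have T_le: "norm (T (Suc n) 0 - T (Suc n) 1) \<le> 2 * norm a * K * (norm a ^ n / fact n)" for n
  proof -
    have "norm (T (Suc n) 0 - T (Suc n) 1) \<le> (2 * norm a * K * (norm a ^ n / fact n)) * norm (0 - 1 :: real)"
    proof (rule differentiable_bound[where S = "{0..1}"])
      fix s :: real assume s: "s \<in> {0..1}"
      show "(T (Suc n) has_derivative (\<lambda>h. h *\<^sub>R ((s * (1 - s\<^sup>2) ^ n) *\<^sub>R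
          (2 * a ^ Suc n / (fact n * fact (Suc n)) * b (Suc n) s)))) (at s within {0..1})"
        using T'[OF s] by (simp add: has_vector_derivative_def)
      have "s\<^sup>2 \<le> 1" using s by (simp add: abs_square_le_1)
      then have "\<bar>s * (1 - s\<^sup>2) ^ n\<bar> \<le> 1"
        using s by (auto simp: abs_mult power_abs intro!: mult_le_one power_le_one)
      moreover have "norm (2 * a ^ Suc n / (fact n * fact (Suc n)) * b (Suc n) s) \<le>
          2 * norm a * K * (norm a ^ n / fact n)"
      proof -
        have "norm (2 * a ^ Suc n / (fact n * fact (Suc n)) * b (Suc n) s) =
            2 * norm a * (norm a ^ n / fact n) * (norm (b (Suc n) s) / fact (Suc n))"
          by (simp add: norm_mult norm_divide norm_power del: fact_Suc)
        also have "\<dots> \<le> 2 * norm a * (norm a ^ n / fact n) * (K / 1)"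
          using b_le[OF s] fact_ge_1
          by (intro mult_left_mono frac_le) (auto intro: order_trans[OF norm_ge_zero] simp del: fact_Suc)
        finally show ?thesis by (simp add: mult_ac)
      qed
      ultimately have *: "norm ((s * (1 - s\<^sup>2) ^ n) *\<^sub>R (2 * a ^ Suc n / (fact n * fact (Suc n)) * b (Suc n) s)) \<le>
          1 * (2 * norm a * K * (norm a ^ n / fact n))"
        unfolding norm_scaleR by (intro mult_mono) auto
      show "onorm (\<lambda>h. h *\<^sub>R ((s * (1 - s\<^sup>2) ^ n) *\<^sub>R (2 * a ^ Suc n / (fact n * fact (Suc n)) * b (Suc n) s))) \<le>
          2 * norm a * K * (norm a ^ n / fact n)"
      proof (rule onorm_le)
        fix h :: real
        show "norm (h *\<^sub>R ((s * (1 - s\<^sup>2) ^ n) *\<^sub>R (2 * a ^ Suc n / (fact n * fact (Suc n)) * b (Suc n) s))) \<le>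
            2 * norm a * K * (norm a ^ n / fact n) * norm h"
          unfolding norm_scaleR[of h] using mult_left_mono[OF *, of "\<bar>h\<bar>"] by (simp add: mult.commute)
      qed
    qed auto
    then show ?thesis by simp
  qed
  have "(\<lambda>n. norm a ^ n / fact n) \<longlonglongrightarrow> 0"
    using summable_LIMSEQ_zero[OF summable_exp[of "norm a"]] by (simp add: divide_inverse mult.commute)
  then have "(\<lambda>n. 2 * norm a * K * (norm a ^ n / fact n)) \<longlonglongrightarrow> 0"
    by (rule tendsto_mult_right_zero)
  then have lim: "(\<lambda>n. T (Suc n) 0 - T (Suc n) 1) \<longlonglongrightarrow> 0"
    by (rule Lim_null_comparison[rotated]) (intro always_eventually allI T_le)
  \<comment> \<open>At \<open>s = 1\<close> only the term \<open>k = 0\<close> remains, with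
    \<open>0 ^ 0 = 1\<close>; \<open>Suc n\<close> ensures that this term is present.\<close>
  have T1: "T (Suc n) 1 = (LINT y:ball 0 1|lborel. v y)" for n
    unfolding T_def sum.lessThan_Suc_shift by (simp add: b_def)
  have T0: "T n 0 = (\<Sum>k<n. of_real (pi powr (real DIM('a) / 2)) * (q k * v 0))" for n
    unfolding T_def
  proof (rule sum.cong[OF refl])
    fix k
    have "b k 0 = of_real (LINT y:ball (0::'a) 1|lborel. (1 - y \<bullet> y) ^ k) * v 0"
      by (simp add: b_def scaleR_conv_of_real flip: set_integral_complex_of_real)
    also have "(LINT y:ball (0::'a) 1|lborel. (1 - y \<bullet> y) ^ k) =
        pi powr (real DIM('a) / 2) * fact k / Gamma (real k + real DIM('a) / 2 + 1)"
      by (rule integral_weight_unit_ball)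
    finally show "(1 - 0\<^sup>2) ^ k *\<^sub>R (a ^ k / (fact k)\<^sup>2 * b k 0) =
        of_real (pi powr (real DIM('a) / 2)) * (q k * v 0)"
      using Gamma_complex_of_real[of "real k + real DIM('a) / 2 + 1"]
      by (simp add: q_def power2_eq_square)
  qed
  have "(\<lambda>n. T (Suc n) 0) \<longlonglongrightarrow> (LINT y:ball 0 1|lborel. v y)"
    using lim unfolding T1 by (rule LIM_zero_cancel)
  then have "(\<lambda>n. T n 0) \<longlonglongrightarrow> (LINT y:ball 0 1|lborel. v y)"
    by (rule LIMSEQ_imp_Suc)
  then have sums: "(\<lambda>k. of_real (pi powr (real DIM('a) / 2)) * (q k * v 0)) sums (LINT y:ball 0 1|lborel. v y)"
    unfolding T0 sums_def .
  \<comment> \<open>Convergence of the series itself is read off from \<open>sums\<close> by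
    dividing by \<open>v 0\<close>. If \<open>v 0 = 0\<close> that is impossible, but then both
    sides are zero.\<close>
  have "(LINT y:ball 0 1|lborel. v y) = of_real (pi powr (real DIM('a) / 2)) * (\<Sum>k. q k) * v 0"
  proof (cases "v 0 = 0")
    case True
    then show ?thesis using sums by (simp add: sums_iff)
  next
    case False
    then have "summable q"
      using sums_summable[OF sums] summable_cmult_iff[of "of_real (pi powr (real DIM('a) / 2)) * v 0" q]
      by (simp add: mult_ac)
    then have "(\<lambda>k. of_real (pi powr (real DIM('a) / 2)) * (q k * v 0)) sums
        (of_real (pi powr (real DIM('a) / 2)) * ((\<Sum>k. q k) * v 0))"
      by (intro sums_mult sums_mult2 summable_sums)
    from sums_unique2[OF sums this] show ?thesis by (simp add: mult.assoc)
  qed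
  then show ?thesis by (simp add: q_def a_def)
qed

section \<open>Flux through a sphere\<close>

lemma integral_scale_measure:
  fixes f :: "'a \<Rightarrow> 'b::{banach, second_countable_topology}"
  assumes c: "c \<ge> 0" and f: "f \<in> borel_measurable M"
  shows "(LINT x|scale_measure (ennreal c) M. f x) = c *\<^sub>R (LINT x|M. f x)"
proof -
  have "scale_measure (ennreal c) M = density M (\<lambda>_. ennreal c)"
    by (rule measure_eqI) (auto simp: emeasure_density nn_integral_cmult_indicator)
  then show ?thesis
    using integral_density[of f M "\<lambda>_. c"] c f by simp
qed

text \<open>Rescaling the punctured ball to radius 1 gives the Jacobian r^m, which with the factor m
  / r in the definition of the measure becomes m r^(m-1).\<close>

lemma integral_sphere_measure:
  fixes F :: "'a::euclidean_space \<Rightarrow> 'b::{banach, second_countable_topology}"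
  assumes r: "r > 0" and F: "F \<in> borel_measurable (restrict_space borel (sphere x r))"
  shows "(LINT y|sphere_measure x r. F y) =
    (real DIM('a) * r ^ (DIM('a) - 1)) *\<^sub>R (LINT z:ball 0 1 - {0}|lborel. F (x + r *\<^sub>R sgn z))"
proof -
  define p where "p y = x + r *\<^sub>R sgn (y - x)" for y
  define B where "B = ball x r - {x}"
  have p: "p \<in> restrict_space lborel B \<rightarrow>\<^sub>M restrict_space borel (sphere x r)"
  proof (rule measurable_restrict_space2)
    show "p \<in> space (restrict_space lborel B) \<rightarrow> sphere x r"
      using r by (auto simp: p_def B_def space_restrict_space dist_norm norm_sgn)
    show "p \<in> restrict_space lborel B \<rightarrow>\<^sub>M borel"
      unfolding p_def sgn_div_norm by (rule measurable_restrict_space1) measurable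
  qed
  have "(\<lambda>y. F (p y)) \<in> borel_measurable (restrict_space lborel B)"
    using measurable_compose[OF p F] .
  then have meas: "(\<lambda>y. indicator B y *\<^sub>R F (p y)) \<in> borel_measurable borel"
    by (subst (asm) borel_measurable_restrict_space_iff) (auto simp: B_def)
  have "(LINT y|sphere_measure x r. F y) =
      (real DIM('a) / r) *\<^sub>R (LINT y|distr (restrict_space lborel B) (restrict_space borel (sphere x r)) p. F y)"
    unfolding sphere_measure_def p_def[symmetric] B_def[symmetric]
    using r F by (intro integral_scale_measure) auto
  also have "(LINT y|distr (restrict_space lborel B) (restrict_space borel (sphere x r)) p. F y) =
      (LINT y|lborel. indicator B y *\<^sub>R F (p y))"
    unfolding integral_distr[OF p F] by (rule integral_restrict_space) (simp add: B_def)
  also have "\<dots> = r ^ DIM('a) *\<^sub>R (LINT z|lborel. indicator B (x + r *\<^sub>R z) *\<^sub>R F (p (x + r *\<^sub>R z)))"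
    by (rule integral_lborel_affine[OF r meas])
  also have "(LINT z|lborel. indicator B (x + r *\<^sub>R z) *\<^sub>R F (p (x + r *\<^sub>R z))) =
      (LINT z:ball 0 1 - {0}|lborel. F (x + r *\<^sub>R sgn z))"
    unfolding set_lebesgue_integral_def
    using r by (intro Bochner_Integration.integral_cong)
      (auto simp: B_def p_def dist_norm sgn_scaleR split: split_indicator)
  finally show ?thesis
    using r by (simp add: power_eq_if)
qed

lemma C1_on_has_vector_derivative:
  assumes "C1_on D f" "i \<in> Basis" "p \<in> D"
  shows "((\<lambda>t. f (p + t *\<^sub>R i)) has_vector_derivative dir_deriv i f p) (at 0)"
  using assms unfolding C1_on_def dir_deriv_def by (auto simp: vector_derivative_works)

lemma C1_on_has_derivative:
  assumes "open D" "C1_on D f" "p \<in> D"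
  shows "(f has_derivative (\<lambda>h. \<Sum>i\<in>Basis. (h \<bullet> i) *\<^sub>R dir_deriv i f p)) (at p)"
  using assms
  by (intro has_derivative_of_continuous_partials C1_on_has_vector_derivative)
    (auto simp: C1_on_def continuous_on_eq_continuous_at)

text \<open>The exterior normal varies over the sphere and is in general no basis vector; the total
  derivative expresses the normal derivative through the partials, whose continuity also gives
  measurability.\<close>

lemma dir_deriv_eq_sum:
  fixes w :: "'a::euclidean_space"
  assumes "open D" "C1_on D f" "p \<in> D"
  shows "dir_deriv w f p = (\<Sum>i\<in>Basis. (w \<bullet> i) *\<^sub>R dir_deriv i f p)"
  unfolding dir_deriv_def[of w]
proof (rule vector_derivative_at)
  have line: "((\<lambda>t. p + t *\<^sub>R w) has_derivative (\<lambda>h. h *\<^sub>R w)) (at 0)"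
    by (auto intro!: derivative_eq_intros)
  have "(f has_derivative (\<lambda>h. \<Sum>i\<in>Basis. (h \<bullet> i) *\<^sub>R dir_deriv i f p)) (at (p + 0 *\<^sub>R w))"
    using C1_on_has_derivative[OF assms] by simp
  from has_derivative_compose[OF line this]
  show "((\<lambda>t. f (p + t *\<^sub>R w)) has_vector_derivative (\<Sum>i\<in>Basis. (w \<bullet> i) *\<^sub>R dir_deriv i f p)) (at 0)"
    by (simp add: has_vector_derivative_def scaleR_sum_right)
qed

theorem theorem2:
  fixes D :: "(real ^ 'n) set" and lam :: complex and u :: "real ^ 'n \<Rightarrow> complex"
  assumes "CARD('n) \<ge> 2"
    and "open D" and "connected D"
    and "C2_on D u" and "metaharmonic_on lam D u"
  shows "\<forall>x r. admissible_ball D x r \<longrightarrow>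
    (LINT y|sphere_measure x r. normal_deriv x r u y) =
      - lam\<^sup>2 * bessel_product CARD('n) r lam * u x"
proof (intro allI impI)
  fix x :: "real ^ 'n" and r :: real
  assume "admissible_ball D x r"
  then have r: "r > 0" and D: "cball x r \<subseteq> D"
    by (auto simp: admissible_ball_def closure_ball)
  define g where "g i = dir_deriv i u" for i
  define h where "h i = dir_deriv i (g i)" for i
  have C1u: "C1_on D u" and C1g: "\<And>i. i \<in> Basis \<Longrightarrow> C1_on D (g i)"
    using \<open>C2_on D u\<close> by (auto simp: C2_on_def g_def)
  have cont: "continuous_on D u" "\<And>i. i \<in> Basis \<Longrightarrow> continuous_on D (g i)"
      "\<And>i. i \<in> Basis \<Longrightarrow> continuous_on D (h i)"
    using C1u C1g by (auto simp: C1_on_def g_def h_def)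
  define v where "v z = u (x + r *\<^sub>R z)" for z
  define G where "G i z = r *\<^sub>R g i (x + r *\<^sub>R z)" for i z
  define H where "H i z = r\<^sup>2 *\<^sub>R h i (x + r *\<^sub>R z)" for i z
  define c where "c = - lam\<^sup>2 * of_real (r\<^sup>2)"
  have inD: "x + r *\<^sub>R z \<in> D" if "z \<in> cball 0 1" for z
    using that r D by (auto simp: dist_norm subset_eq)
  have inD': "x + r *\<^sub>R z \<in> D" if "z \<in> ball 0 1" for z
    using inD that by auto
  have cont_scaled: "continuous_on (cball 0 1) (\<lambda>z. f (x + r *\<^sub>R z))"
    if "continuous_on D f" for f :: "real ^ 'n \<Rightarrow> complex"
    by (rule continuous_on_compose2[OF that]) (use inD in \<open>auto intro!: continuous_intros\<close>)
  have v: "continuous_on (cball 0 1) v"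
    unfolding v_def by (intro cont_scaled cont)
  have G: "continuous_on (cball 0 1) (G i)" and H: "continuous_on (cball 0 1) (H i)" if "i \<in> Basis" for i
    using that unfolding G_def[abs_def] H_def[abs_def] by (auto intro!: continuous_intros cont_scaled cont)
  have v': "(v has_derivative (\<lambda>w. \<Sum>i\<in>Basis. (w \<bullet> i) *\<^sub>R G i z)) (at z)" if z: "z \<in> ball 0 1" for z
  proof -
    have "((\<lambda>z. x + r *\<^sub>R z) has_derivative (\<lambda>w. r *\<^sub>R w)) (at z)"
      by (auto intro!: derivative_eq_intros)
    from has_derivative_compose[OF this C1_on_has_derivative[OF \<open>open D\<close> C1u inD'[OF z]]]
    show ?thesis by (simp add: v_def[abs_def] G_def g_def mult.commute)
  qed
  have G': "((\<lambda>t. G i (z + t *\<^sub>R i)) has_vector_derivative H i z) (at 0)"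
    if i: "i \<in> Basis" and z: "z \<in> ball 0 1" for i z
  proof -
    have "((\<lambda>t. g i (x + r *\<^sub>R z + t *\<^sub>R i)) \<circ> (\<lambda>t. r * t) has_vector_derivative r *\<^sub>R h i (x + r *\<^sub>R z)) (at 0)"
      by (rule vector_diff_chain_at)
        (use C1_on_has_vector_derivative[OF C1g[OF i] i inD'[OF z]] in \<open>auto intro!: derivative_eq_intros simp: h_def\<close>)
    then have "((\<lambda>t. r *\<^sub>R g i (x + r *\<^sub>R (z + t *\<^sub>R i))) has_vector_derivative r *\<^sub>R (r *\<^sub>R h i (x + r *\<^sub>R z))) (at 0)"
      by (intro bounded_linear.has_vector_derivative[OF bounded_linear_scaleR_right])
        (simp add: o_def scaleR_add_right add.assoc)
    then show ?thesis by (simp add: G_def H_def power2_eq_square)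
  qed
  have lap: "(\<Sum>i\<in>Basis. H i z) = c * v z" if z: "z \<in> ball 0 1" for z
  proof -
    have "(\<Sum>i\<in>Basis. h i (x + r *\<^sub>R z)) = - lam\<^sup>2 * u (x + r *\<^sub>R z)"
      using \<open>metaharmonic_on lam D u\<close> inD'[OF z]
      by (auto simp: metaharmonic_on_def laplacian_def h_def g_def eq_neg_iff_add_eq_0)
    then show ?thesis
      unfolding H_def c_def v_def scaleR_sum_right[symmetric] by (simp add: scaleR_conv_of_real)
  qed
  have sph: "sphere x r \<subseteq> D"
    using D by auto
  have normal: "normal_deriv x r u y = (\<Sum>i\<in>Basis. (((y - x) /\<^sub>R r) \<bullet> i) *\<^sub>R g i y)" if "y \<in> sphere x r" for y
    unfolding normal_deriv_def sphere_normal_def g_def using that sph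
    by (intro dir_deriv_eq_sum[OF \<open>open D\<close> C1u]) auto
  have "(LINT y|sphere_measure x r. normal_deriv x r u y) =
      (LINT y|sphere_measure x r. (\<Sum>i\<in>Basis. (((y - x) /\<^sub>R r) \<bullet> i) *\<^sub>R g i y))"
    by (intro Bochner_Integration.integral_cong refl) (simp add: normal)
  also have "\<dots> = (real CARD('n) * r ^ (CARD('n) - 1)) *\<^sub>R
      (LINT z:ball 0 1 - {0}|lborel. (\<Sum>i\<in>Basis. (((x + r *\<^sub>R sgn z - x) /\<^sub>R r) \<bullet> i) *\<^sub>R g i (x + r *\<^sub>R sgn z)))"
    using r sph
    by (subst integral_sphere_measure)
      (auto intro!: borel_measurable_continuous_on_restrict continuous_intros continuous_on_subset[OF cont(2)])
  \<comment> \<open>The puncture can be filled in because \<open>sgn 0 = 0\<close> makes the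
    right-hand integrand vanish at the origin; \<open>1 / r\<close> compensates for the factor
    \<open>r\<close> in \<open>G\<close>.\<close>
  also have "(LINT z:ball 0 1 - {0}|lborel. (\<Sum>i\<in>Basis. (((x + r *\<^sub>R sgn z - x) /\<^sub>R r) \<bullet> i) *\<^sub>R g i (x + r *\<^sub>R sgn z))) =
      (LINT z:ball 0 1|lborel. (1 / r) *\<^sub>R (\<Sum>i\<in>Basis. (sgn z \<bullet> i) *\<^sub>R G i (sgn z)))"
    unfolding set_lebesgue_integral_def using r
    by (intro Bochner_Integration.integral_cong) (auto simp: G_def scaleR_sum_right split: split_indicator)
  also have "\<dots> = (1 / r) *\<^sub>R (LINT z:ball 0 1|lborel. (\<Sum>i\<in>Basis. (sgn z \<bullet> i) *\<^sub>R G i (sgn z)))"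
    by (rule set_integral_scaleR_right)
  also have "(LINT z:ball 0 1|lborel. (\<Sum>i\<in>Basis. (sgn z \<bullet> i) *\<^sub>R G i (sgn z))) =
      (\<Sum>i\<in>Basis. LINT z:ball 0 1|lborel. (sgn z \<bullet> i) *\<^sub>R G i (sgn z))"
    by (intro set_integral_sum radial_projection_integrable G)
  \<comment> \<open>The dimension in the sphere measure is absorbed by the one in the divergence
    theorem.\<close>
  also have "(real CARD('n) * r ^ (CARD('n) - 1)) *\<^sub>R (1 / r) *\<^sub>R \<dots> =
      (r ^ (CARD('n) - 1) / r) *\<^sub>R (\<Sum>i\<in>Basis. LINT z:ball 0 1|lborel. H i z)"
    using divergence_unit_ball[OF _ G H G'] by (simp add: scaleR_sum_right mult.commute)
  also have "(\<Sum>i\<in>Basis. LINT z:ball 0 1|lborel. H i z) = (LINT z:ball 0 1|lborel. (\<Sum>i\<in>Basis. H i z))"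
    by (intro set_integral_sum[symmetric] set_integrable_unit_ball H)
  also have "\<dots> = (LINT z:ball 0 1|lborel. c * v z)"
    using lap by (intro set_lebesgue_integral_cong) auto
  also have "\<dots> = c * (LINT z:ball 0 1|lborel. v z)"
    by (rule set_integral_mult_right)
  also have "(LINT z:ball 0 1|lborel. v z) = of_real (pi powr (real CARD('n) / 2)) *
      (\<Sum>k. (c / 4) ^ k / (fact k * Gamma (of_nat k + of_nat CARD('n) / 2 + 1))) * v 0"
    using integral_unit_ball_metaharmonic[OF v v' G H G' lap] by simp
  also have "(\<Sum>k. (c / 4) ^ k / (fact k * Gamma (of_nat k + of_nat CARD('n) / 2 + 1))) =
      (\<Sum>k. (-1) ^ k * (lam * of_real r / 2) ^ (2 * k) / (fact k * Gamma (of_nat k + of_nat CARD('n) / 2 + 1)))"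
  proof -
    have "c / 4 = - 1 * (lam * of_real r / 2)\<^sup>2"
      by (simp add: c_def power2_eq_square)
    then have "(c / 4) ^ k = (-1) ^ k * (lam * of_real r / 2) ^ (2 * k)" for k
      by (simp only: power_mult_distrib power_mult)
    then show ?thesis by simp
  qed
  finally have flux: "(LINT y|sphere_measure x r. normal_deriv x r u y) =
      (r ^ (CARD('n) - 1) / r) *\<^sub>R (c * (of_real (pi powr (real CARD('n) / 2)) *
      (\<Sum>k. (-1) ^ k * (lam * of_real r / 2) ^ (2 * k) / (fact k * Gamma (of_nat k + of_nat CARD('n) / 2 + 1))) * v 0))" .
  \<comment> \<open>Power count: r^(m-2) from the flux and r^2 from \<open>c\<close> give the r^m of
    \<open>bessel_product\<close>.\<close>
  have "r ^ (CARD('n) - 1) / r * r\<^sup>2 = r ^ CARD('n)"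
    using r by (simp add: power_eq_if power2_eq_square)
  then have "of_real (r ^ (CARD('n) - 1) / r) * c = - lam\<^sup>2 * of_real (r ^ CARD('n))"
    unfolding c_def by (metis mult.left_commute of_real_mult)
  then show "(LINT y|sphere_measure x r. normal_deriv x r u y) =
      - lam\<^sup>2 * bessel_product CARD('n) r lam * u x"
    unfolding flux bessel_product_def scaleR_conv_of_real mult.assoc[symmetric]
    by (simp add: v_def mult_ac)
qed

end
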